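(* Let $R$ be a ring. The following statements are equivalent. 1. $Q_{l,cl}(R)$ (exists and) is a semisimple ring. 2. $Q_l(R)$ is a semisimple ring. 3. (a) $Q_l^s(R)$ is a semisimple ring, and (b) $\mathfrak{l}^s_R=0$. If one of the equivalent conditions 1–3 holds then $Q_{l,cl}(R)\simeq Q_l(R)\simeq Q_l^s(R)$ and $\mathcal{C}_R=T_l(R)=\mathcal{L}^s_l(R)$.
   Context: Rings are associative with $1$ and nonzero. A multiplicative subset $S$ of $R$ is a submonoid of $(R,\cdot)$ with $1\in S$, $0\notin S$. It is a left Ore set if $Sr\cap Rs\neq\emptyset$ for all $r\in R$, $s\in S$; then $\mathrm{ass}(S):=\{r\in R\mid sr=0 \text{ for some } s\in S\}$ is an ideal. A left Ore set $S$ is a left denominator set if $rs=0$ with $r\in R$, $s\in S$ implies $r\in\mathrm{ass}(S)$. $\mathrm{Den}_l(R)$ is the set of left denominator sets of $R$; for $S\in\mathrm{Den}_l(R)$, $S^{-1}R=\{s^{-1}r\mid s\in S,r\in R\}$ is the left localization. $\mathrm{max.Den}_l(R)$ is the (non-empty) set of elements of $\mathrm{Den}_l(R)$ maximal under inclusion. $\mathcal{L}^s_l(R):=\bigcap_{S\in \mathrm{max.Den}_l(R)}S$. $T_l(R)$ is the union of all $S\in\mathrm{Den}_l(R)$ with $S\subseteq\mathcal{L}^s_l(R)$; it is the largest left denominator set of $R$ contained in $\mathcal{L}^s_l(R)$. $Q_l^s(R):=T_l(R)^{-1}R$ and $\mathfrak{l}^s_R:=\mathrm{ass}(T_l(R))$.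 $S_{l,0}(R)$ is the largest (under inclusion) left denominator set $S$ of $R$ with $\mathrm{ass}(S)=0$ (it exists), and $Q_l(R):=S_{l,0}(R)^{-1}R$. $\mathcal{C}_R$ is the set of regular elements (non-zero-divisors) of $R$, and $Q_{l,cl}(R):=\mathcal{C}_R^{-1}R$ is the classical left quotient ring, which exists iff $\mathcal{C}_R$ is a left Ore set. "Semisimple" means semisimple Artinian. *)

theory Defs
  imports "HOL-Algebra.QuotRing"
begin

definition left_ore_set :: "('a, 'm) ring_scheme \<Rightarrow> 'a set \<Rightarrow> bool" where
  "left_ore_set R S \<longleftrightarrow>
     submonoid S R \<and> \<zero>\<^bsub>R\<^esub> \<notin> S \<and>
     (\<forall>r\<in>carrier R. \<forall>s\<in>S. {t \<otimes>\<^bsub>R\<^esub> r | t. t \<in> S} \<inter> {q \<otimes>\<^bsub>R\<^esub> s | q. q \<in> carrier R} \<noteq> {})"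

definition ass :: "('a, 'm) ring_scheme \<Rightarrow> 'a set \<Rightarrow> 'a set" where
  "ass R S = {r \<in> carrier R. \<exists>s\<in>S. s \<otimes>\<^bsub>R\<^esub> r = \<zero>\<^bsub>R\<^esub>}"

definition Den_l :: "('a, 'm) ring_scheme \<Rightarrow> 'a set set" where
  "Den_l R = {S. left_ore_set R S \<and>
     (\<forall>r\<in>carrier R. \<forall>s\<in>S. r \<otimes>\<^bsub>R\<^esub> s = \<zero>\<^bsub>R\<^esub> \<longrightarrow> r \<in> ass R S)}"

text \<open>
  The left localization of \<open>R\<close> at a left denominator set \<open>S\<close> is Ore's ring of left fractions.
  A pair \<open>(s, r)\<close> stands for the fraction \<open>s\<inverse> r\<close>; two fractions are equal iff they can be
  expanded to a common denominator in \<open>S\<close> with the same numerator.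
\<close>

definition ore_rel :: "('a, 'm) ring_scheme \<Rightarrow> 'a set \<Rightarrow> (('a \<times> 'a) \<times> ('a \<times> 'a)) set" where
  "ore_rel R S = {((s, r), (t, q)). s \<in> S \<and> r \<in> carrier R \<and> t \<in> S \<and> q \<in> carrier R \<and>
     (\<exists>a\<in>carrier R. \<exists>b\<in>carrier R.
        a \<otimes>\<^bsub>R\<^esub> s = b \<otimes>\<^bsub>R\<^esub> t \<and> a \<otimes>\<^bsub>R\<^esub> s \<in> S \<and> a \<otimes>\<^bsub>R\<^esub> r = b \<otimes>\<^bsub>R\<^esub> q)}"

definition left_frac :: "('a, 'm) ring_scheme \<Rightarrow> 'a set \<Rightarrow> 'a \<Rightarrow> 'a \<Rightarrow> ('a \<times> 'a) set" where
  "left_frac R S s r = ore_rel R S `` {(s, r)}"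

text \<open>
  The operations are given by the formulas
  \<open>s\<inverse> r + t\<inverse> q = (a s)\<inverse> (a r + b q)\<close> whenever \<open>a s = b t \<in> S\<close>, and
  \<open>s\<inverse> r \<cdot> t\<inverse> q = (u s)\<inverse> (a q)\<close> whenever \<open>u \<in> S\<close> and \<open>u r = a t\<close>.
  Instead of choosing representatives and multipliers, we take the union of the results over all
  possible choices; for a left denominator set all of these results are the same equivalence class.
\<close>

definition left_localization ::
    "('a, 'm) ring_scheme \<Rightarrow> 'a set \<Rightarrow> ('a \<times> 'a) set ring" where
  "left_localization R S = \<lparr>
     carrier = (S \<times> carrier R) // ore_rel R S,
     mult = (\<lambda>X Y. \<Union> {left_frac R S (u \<otimes>\<^bsub>R\<^esub> s) (a \<otimes>\<^bsub>R\<^esub> q) | s r t q u a.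
       (s, r) \<in> X \<and> (t, q) \<in> Y \<and> u \<in> S \<and> a \<in> carrier R \<and>
       u \<otimes>\<^bsub>R\<^esub> r = a \<otimes>\<^bsub>R\<^esub> t}),
     one = left_frac R S \<one>\<^bsub>R\<^esub> \<one>\<^bsub>R\<^esub>,
     zero = left_frac R S \<one>\<^bsub>R\<^esub> \<zero>\<^bsub>R\<^esub>,
     add = (\<lambda>X Y. \<Union> {left_frac R S (a \<otimes>\<^bsub>R\<^esub> s) (a \<otimes>\<^bsub>R\<^esub> r \<oplus>\<^bsub>R\<^esub> b \<otimes>\<^bsub>R\<^esub> q) | s r t q a b.
       (s, r) \<in> X \<and> (t, q) \<in> Y \<and> a \<in> carrier R \<and> b \<in> carrier R \<and>
       a \<otimes>\<^bsub>R\<^esub> s = b \<otimes>\<^bsub>R\<^esub> t \<and> a \<otimes>\<^bsub>R\<^esub> s \<in> S}) \<rparr>"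

definition max_Den_l :: "('a, 'm) ring_scheme \<Rightarrow> 'a set set" where
  "max_Den_l R = {S \<in> Den_l R. \<forall>S'\<in>Den_l R. S \<subseteq> S' \<longrightarrow> S' = S}"

definition strong_l :: "('a, 'm) ring_scheme \<Rightarrow> 'a set"  (\<open>\<L>\<^sup>s\<^sub>l\<close>) where
  "\<L>\<^sup>s\<^sub>l R = \<Inter> (max_Den_l R)"

definition T_l :: "('a, 'm) ring_scheme \<Rightarrow> 'a set" where
  "T_l R = \<Union> {S \<in> Den_l R. S \<subseteq> \<L>\<^sup>s\<^sub>l R}"

definition Q_l_s :: "('a, 'm) ring_scheme \<Rightarrow> ('a \<times> 'a) set ring" where
  "Q_l_s R = left_localization R (T_l R)"

definition strong_radical_l :: "('a, 'm) ring_scheme \<Rightarrow> 'a set"  (\<open>\<ll>\<^sup>s\<close>) where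
  "\<ll>\<^sup>s R = ass R (T_l R)"

definition S_l_0 :: "('a, 'm) ring_scheme \<Rightarrow> 'a set" where
  "S_l_0 R = (GREATEST S. S \<in> Den_l R \<and> ass R S = {\<zero>\<^bsub>R\<^esub>})"

definition Q_l :: "('a, 'm) ring_scheme \<Rightarrow> ('a \<times> 'a) set ring" where
  "Q_l R = left_localization R (S_l_0 R)"

definition regular_elements :: "('a, 'm) ring_scheme \<Rightarrow> 'a set"  (\<open>\<C>\<close>) where
  "\<C> R = {c \<in> carrier R. \<forall>x\<in>carrier R.
     (c \<otimes>\<^bsub>R\<^esub> x = \<zero>\<^bsub>R\<^esub> \<longrightarrow> x = \<zero>\<^bsub>R\<^esub>) \<and> (x \<otimes>\<^bsub>R\<^esub> c = \<zero>\<^bsub>R\<^esub> \<longrightarrow> x = \<zero>\<^bsub>R\<^esub>)}"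

text \<open>
  As a term \<open>Q_l_cl R\<close> is always defined, but it is the classical left quotient ring only when
  \<open>\<C> R\<close> is a left Ore set, i.e. when \<open>Q_l_cl_exists R\<close> holds.
\<close>

definition Q_l_cl_exists :: "('a, 'm) ring_scheme \<Rightarrow> bool" where
  "Q_l_cl_exists R \<longleftrightarrow> left_ore_set R (\<C> R)"

definition Q_l_cl :: "('a, 'm) ring_scheme \<Rightarrow> ('a \<times> 'a) set ring" where
  "Q_l_cl R = left_localization R (\<C> R)"

text \<open>
  HOL-Algebra's modules are over commutative rings only, so the conditions on the left regular
  module are spelled out through its submodules, the left ideals.
\<close>

definition left_ideal :: "'a set \<Rightarrow> ('a, 'm) ring_scheme \<Rightarrow> bool" where
  "left_ideal I R \<longleftrightarrow>
     additive_subgroup I R \<and> (\<forall>r\<in>carrier R. \<forall>x\<in>I. r \<otimes>\<^bsub>R\<^esub> x \<in> I)"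

definition left_artinian :: "('a, 'm) ring_scheme \<Rightarrow> bool" where
  "left_artinian R \<longleftrightarrow>
     (\<forall>I :: nat \<Rightarrow> 'a set. (\<forall>n. left_ideal (I n) R) \<and> (\<forall>n. I (Suc n) \<subseteq> I n)
        \<longrightarrow> (\<exists>n. \<forall>m\<ge>n. I m = I n))"

text \<open>
  Semisimple Artinian: a nonzero left Artinian ring whose left regular module is semisimple, i.e.
  every left ideal is a direct summand.
\<close>

definition semisimple_ring :: "('a, 'm) ring_scheme \<Rightarrow> bool" where
  "semisimple_ring R \<longleftrightarrow>
     ring R \<and> \<one>\<^bsub>R\<^esub> \<noteq> \<zero>\<^bsub>R\<^esub> \<and> left_artinian R \<and>
     (\<forall>I. left_ideal I R \<longrightarrow>
        (\<exists>J. left_ideal J R \<and> I <+>\<^bsub>R\<^esub> J = carrier R \<and> I \<inter> J = {\<zero>\<^bsub>R\<^esub>}))"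

end

theory Submission
  imports Defs "HOL-Algebra.Multiplicative_Group"
begin

text \<open>
  If a left Ore set of regular elements has a semisimple (in fact left Artinian) localization \<open>Q\<close>,
  then every regular element of \<open>R\<close> is a unit of \<open>Q\<close>, because a right non-zero-divisor \<open>u\<close> of a left
  Artinian ring is a unit (the chain \<open>Q u\<^sup>n\<close> stabilizes). Hence \<open>\<C> R\<close> is a left Ore set, and it remains
  to show that it is the intersection of the maximal left denominator sets.

  For a left denominator set \<open>S\<close> the ideal \<open>ass R S\<close> is cut out by a central idempotent \<open>e\<close> of \<open>Q\<close>, and
  the elements of \<open>S\<close> are regular on \<open>Q (1 - e)\<close>. So the monoid generated by \<open>S\<close> and \<open>\<C> R\<close> does not
  contain \<open>0\<close> and is again a left denominator set, whence \<open>\<C> R \<subseteq> S\<close> if \<open>S\<close> is maximal. Conversely, let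
  \<open>x\<close> lie in all maximal sets and let \<open>y x = 0\<close> with \<open>y \<noteq> 0\<close>. If \<open>f\<close> is the central idempotent generating
  \<open>Q y Q\<close>, then the elements of \<open>R\<close> that are regular on \<open>Q f\<close> form a left denominator set. For a maximal
  set \<open>S\<close> above it, with idempotent \<open>e\<close>, \<open>y x = 0\<close> forces \<open>y = y e\<close>, hence \<open>f = f e\<close>. But then some element
  of \<open>S \<inter> Q f\<close> lies in \<open>ass R S\<close>, that is, \<open>0 \<in> S\<close>.
\<close>

section \<open>Left ideals of semisimple rings\<close>

context ring begin

lemma minus_mult_distrib:
  assumes "x \<in> carrier R" "y \<in> carrier R" "z \<in> carrier R"
  shows "(x \<ominus> y) \<otimes> z = x \<otimes> z \<ominus> y \<otimes> z" and "z \<otimes> (x \<ominus> y) = z \<otimes> x \<ominus> z \<otimes> y"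
  using assms by (simp_all add: minus_eq l_distr r_distr l_minus r_minus)

lemma m_rcancel_if:
  assumes "\<And>z. z \<in> carrier R \<Longrightarrow> z \<otimes> u = \<zero> \<Longrightarrow> z = \<zero>"
    and "u \<in> carrier R" "x \<in> carrier R" "y \<in> carrier R" "x \<otimes> u = y \<otimes> u"
  shows "x = y"
proof -
  have "(x \<ominus> y) \<otimes> u = \<zero>"
    using assms(2-4) by (simp add: minus_mult_distrib(1) assms(5))
  then have "x \<ominus> y = \<zero>" by (rule assms(1)[rotated]) (simp add: assms(3,4))
  then show ?thesis using assms(3,4) by simp
qed

lemma right_annihilator_pow_zero:
  assumes u: "u \<in> carrier R" and canc: "\<And>z. z \<in> carrier R \<Longrightarrow> z \<otimes> u = \<zero> \<Longrightarrow> z = \<zero>"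
    and "z \<in> carrier R" "z \<otimes> u [^] (n::nat) = \<zero>"
  shows "z = \<zero>"
  using assms(3,4)
proof (induction n)
  case (Suc n)
  have "(z \<otimes> u [^] n) \<otimes> u = \<zero>" using Suc.prems u by (simp add: m_assoc)
  then have "z \<otimes> u [^] n = \<zero>" using canc[of "z \<otimes> u [^] n"] Suc.prems u by auto
  with Suc show ?case by blast
qed simp

lemma left_idealI:
  assumes "I \<subseteq> carrier R" "\<zero> \<in> I" "\<And>x y. x \<in> I \<Longrightarrow> y \<in> I \<Longrightarrow> x \<oplus> y \<in> I"
    and l: "\<And>r x. r \<in> carrier R \<Longrightarrow> x \<in> I \<Longrightarrow> r \<otimes> x \<in> I"
  shows "left_ideal I R"
proof -
  have "\<ominus> x \<in> I" if "x \<in> I" for x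
    using l[of "\<ominus> \<one>" x] that assms(1) by (auto simp: l_minus)
  then have "subgroup I (add_monoid R)"
    using assms by (intro add.subgroupI) (auto simp: a_inv_def)
  then show ?thesis
    unfolding left_ideal_def using l by (auto intro: additive_subgroupI)
qed

lemma left_idealD:
  assumes "left_ideal I R"
  shows "I \<subseteq> carrier R" "\<zero> \<in> I" "\<And>x y. x \<in> I \<Longrightarrow> y \<in> I \<Longrightarrow> x \<oplus> y \<in> I"
    "\<And>r x. r \<in> carrier R \<Longrightarrow> x \<in> I \<Longrightarrow> r \<otimes> x \<in> I" "\<And>x. x \<in> I \<Longrightarrow> \<ominus> x \<in> I"
    "\<And>x y. x \<in> I \<Longrightarrow> y \<in> I \<Longrightarrow> x \<ominus> y \<in> I"
proof -
  interpret additive_subgroup I R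
    using assms by (simp add: left_ideal_def)
  show *: "I \<subseteq> carrier R" "\<zero> \<in> I" "\<And>x y. x \<in> I \<Longrightarrow> y \<in> I \<Longrightarrow> x \<oplus> y \<in> I"
    "\<And>r x. r \<in> carrier R \<Longrightarrow> x \<in> I \<Longrightarrow> r \<otimes> x \<in> I"
    using assms a_subset by (auto simp: left_ideal_def)
  show m: "\<And>x. x \<in> I \<Longrightarrow> \<ominus> x \<in> I"
    by (rule a_inv_closed)
  show "\<And>x y. x \<in> I \<Longrightarrow> y \<in> I \<Longrightarrow> x \<ominus> y \<in> I"
    using * m by (simp add: minus_eq)
qed

lemma left_ideal_if_ideal: "ideal I R \<Longrightarrow> left_ideal I R"
  by (simp add: left_ideal_def ideal.axioms(1) ideal.I_l_closed)

lemma ideal_if_left_ideal: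
  assumes "left_ideal I R" "\<And>x r. x \<in> I \<Longrightarrow> r \<in> carrier R \<Longrightarrow> x \<otimes> r \<in> I"
  shows "ideal I R"
proof (rule idealI[OF ring_axioms])
  show "subgroup I (add_monoid R)"
    using assms(1) by (simp add: left_ideal_def additive_subgroup.a_subgroup)
qed (use assms left_idealD(4)[OF assms(1)] in blast)+

lemma left_ideal_carrier: "left_ideal (carrier R) R"
  by (rule left_idealI) auto

section \<open>Right multiplication under the descending chain condition\<close>

text \<open>The left ideals \<open>B u^n\<close> descend because \<open>B u\<close> lies in
  \<open>B\<close>. Once two neighbours agree, \<open>b u^n = a u^(n+1)\<close>, and cancelling
  \<open>u^n\<close> on the right gives \<open>b = a u\<close>. The whole ring as \<open>B\<close>
  yields inverses; an extended ideal as \<open>B\<close> yields closure under right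
  multiplication.\<close>

lemma left_artinian_right_mult_stable:
  assumes "left_artinian R" and B: "left_ideal B R" and u: "u \<in> carrier R"
    and canc: "\<And>z. z \<in> carrier R \<Longrightarrow> z \<otimes> u = \<zero> \<Longrightarrow> z = \<zero>"
    and stable: "\<And>b. b \<in> B \<Longrightarrow> b \<otimes> u \<in> B" and b: "b \<in> B"
  shows "\<exists>b'\<in>B. b = b' \<otimes> u"
proof -
  note BD = left_idealD[OF B]
  define I where "I n = (\<lambda>b. b \<otimes> u [^] n) ` B" for n :: nat
  have "left_ideal (I n) R" for n
  proof (rule left_idealI)
    show "I n \<subseteq> carrier R" using BD(1) u by (auto simp: I_def)
    show "\<zero> \<in> I n" using BD(2) u by (force simp: I_def image_iff)
    show "x \<oplus> y \<in> I n" if xy: "x \<in> I n" "y \<in> I n" for x y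
    proof -
      obtain a c where "a \<in> B" "c \<in> B" "x = a \<otimes> u [^] n" "y = c \<otimes> u [^] n"
        using xy by (auto simp: I_def)
      then show ?thesis
        using BD(1,3) u by (auto simp: I_def l_distr subset_iff intro!: image_eqI[of _ _ "a \<oplus> c"])
    qed
    show "r \<otimes> x \<in> I n" if rx: "r \<in> carrier R" "x \<in> I n" for r x
    proof -
      obtain a where "a \<in> B" "x = a \<otimes> u [^] n"
        using rx by (auto simp: I_def)
      then show ?thesis
        using BD(1,4) u rx
        by (auto simp: I_def m_assoc subset_iff intro!: image_eqI[of _ _ "r \<otimes> a"])
    qed
  qed
  \<comment> \<open>The new factor \<open>u\<close> is split off next to \<open>a\<close>, so that
    \<open>a \<otimes> u\<close> stays in \<open>B\<close> and the remaining power can be cancelled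
    on the right.\<close>
  moreover have shift: "a \<otimes> u [^] Suc n = (a \<otimes> u) \<otimes> u [^] n" if "a \<in> B" for a n
    unfolding nat_pow_Suc2[OF u] using subsetD[OF BD(1) that] u by (simp add: m_assoc)
  then have "I (Suc n) \<subseteq> I n" for n
    using stable by (auto simp: I_def simp del: nat_pow_Suc)
  ultimately obtain n where "I (Suc n) = I n"
    using \<open>left_artinian R\<close> unfolding left_artinian_def by (metis le_SucI order_refl)
  then have "b \<otimes> u [^] n \<in> I (Suc n)"
    using b by (auto simp: I_def)
  then obtain a where "a \<in> B" "b \<otimes> u [^] n = a \<otimes> u [^] Suc n"
    by (auto simp: I_def simp del: nat_pow_Suc)
  then have a: "a \<in> B" "b \<otimes> u [^] n = (a \<otimes> u) \<otimes> u [^] n"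
    using shift by auto
  have "b = a \<otimes> u"
    by (rule m_rcancel_if[OF right_annihilator_pow_zero[OF u canc] _ _ _ a(2)])
      (use a(1) b BD(1) u in auto)
  with a show ?thesis by auto
qed

lemma left_artinian_Units:
  assumes "left_artinian R" and u: "u \<in> carrier R"
    and canc: "\<And>z. z \<in> carrier R \<Longrightarrow> z \<otimes> u = \<zero> \<Longrightarrow> z = \<zero>"
  shows "u \<in> Units R"
proof -
  obtain v where v: "v \<in> carrier R" "v \<otimes> u = \<one>"
    using left_artinian_right_mult_stable[OF assms(1) left_ideal_carrier u canc, of \<one>] u
    by (metis m_closed one_closed)
  \<comment> \<open>The chain condition gives only the left inverse \<open>v\<close>; right
    cancellation of \<open>u\<close> makes it two-sided.\<close>
  have "(u \<otimes> v) \<otimes> u = \<one> \<otimes> u"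
    using u v by (simp add: m_assoc)
  then have "u \<otimes> v = \<one>"
    by (rule m_rcancel_if[OF canc u, rotated -1]) (use u v in auto)
  with u v show ?thesis by (auto simp: Units_def)
qed

section \<open>Idempotents generating ideals of a semisimple ring\<close>

text \<open>Here \<open>e\<close> is the component of \<open>\<one>\<close> in \<open>B\<close> for
  a complement \<open>J\<close>. The difference of \<open>b\<close> and \<open>b \<otimes> e\<close>
  is \<open>b \<otimes> j\<close>, which lies in both \<open>B\<close> and \<open>J\<close>.\<close>

lemma semisimple_left_ideal_right_identity:
  assumes "semisimple_ring R" and B: "left_ideal B R"
  obtains e where "e \<in> B" "\<And>b. b \<in> B \<Longrightarrow> b \<otimes> e = b"
proof -
  obtain J where J: "left_ideal J R" "B <+> J = carrier R" "B \<inter> J = {\<zero>}"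
    using assms unfolding semisimple_ring_def by blast
  note BD = left_idealD[OF B] and JD = left_idealD[OF J(1)]
  have "\<one> \<in> B <+> J" using J by simp
  then obtain e j where e: "e \<in> B" "j \<in> J" "\<one> = e \<oplus> j"
    by (auto simp: set_add_def set_mult_def)
  have "b \<otimes> e = b" if b: "b \<in> B" for b
  proof -
    have c: "b \<in> carrier R" "e \<in> carrier R" "j \<in> carrier R"
      using b e BD(1) JD(1) by auto
    have "b = b \<otimes> e \<oplus> b \<otimes> j"
      using c e(3) by (metis r_distr r_one)
    then have "b \<otimes> j = b \<ominus> b \<otimes> e"
      using c by (metis a_comm add.m_closed a_minus_def add.inv_solve_right m_closed)
    then have "b \<otimes> j \<in> B"
      using b c(1) BD(6) BD(4)[OF c(1) e(1)] by simp
    moreover have "b \<otimes> j \<in> J" using c(1) e(2) JD(4) by blast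
    ultimately have "b \<otimes> j = \<zero>" using J by auto
    with \<open>b = b \<otimes> e \<oplus> b \<otimes> j\<close> c show ?thesis by simp
  qed
  with e that show ?thesis by blast
qed

text \<open>The right identity \<open>e\<close> of \<open>B\<close> is also a left identity, since
  the part of \<open>B\<close> killed by \<open>e\<close> on the left vanishes. Then
  \<open>x \<otimes> e\<close> and \<open>e \<otimes> x\<close> both equal
  \<open>e \<otimes> x \<otimes> e\<close>.\<close>

lemma semisimple_ideal_central_identity:
  assumes "semisimple_ring R" and B: "ideal B R"
  obtains e where "e \<in> B" "\<And>b. b \<in> B \<Longrightarrow> b \<otimes> e = b" "\<And>x. x \<in> carrier R \<Longrightarrow> x \<otimes> e = e \<otimes> x"
proof -
  interpret B: ideal B R by fact
  note Bl = left_ideal_if_ideal[OF B]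
  note BD = left_idealD[OF Bl]
  obtain e where e: "e \<in> B" "\<And>b. b \<in> B \<Longrightarrow> b \<otimes> e = b"
    using semisimple_left_ideal_right_identity[OF assms(1) Bl] by blast
  have ec: "e \<in> carrier R" using e BD by auto
  \<comment> \<open>A left ideal with square zero, hence trivial by semisimplicity.\<close>
  define N where "N = {b \<in> B. e \<otimes> b = \<zero>}"
  have "left_ideal N R"
  proof (rule left_idealI)
    show "r \<otimes> x \<in> N" if "r \<in> carrier R" "x \<in> N" for r x
    proof -
      have x: "x \<in> carrier R" "x \<in> B" "e \<otimes> x = \<zero>" using that BD(1) by (auto simp: N_def)
      \<comment> \<open>\<open>e \<otimes> r\<close> lies in the two-sided ideal \<open>B\<close>,
        so it absorbs \<open>e\<close> on the right; this carries
        \<open>e \<otimes> x = \<zero>\<close> over to \<open>r \<otimes> x\<close>.\<close>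
      have "e \<otimes> r = (e \<otimes> r) \<otimes> e"
        using e that by (simp add: B.I_r_closed)
      then have "e \<otimes> (r \<otimes> x) = (e \<otimes> r) \<otimes> (e \<otimes> x)"
        using x that ec by (metis m_assoc m_closed)
      then show ?thesis using x that ec BD by (auto simp: N_def)
    qed
  qed (use BD ec in \<open>auto simp: N_def r_distr subset_iff\<close>)
  then obtain f where f: "f \<in> N" "\<And>n. n \<in> N \<Longrightarrow> n \<otimes> f = n"
    using semisimple_left_ideal_right_identity[OF assms(1)] by blast
  have N0: "n = \<zero>" if n: "n \<in> N" for n
  proof -
    have c: "n \<in> carrier R" "f \<in> carrier R" "n \<in> B" "e \<otimes> f = \<zero>"
      using n f BD(1) by (auto simp: N_def)
    \<comment> \<open>\<open>e\<close> fixes \<open>n\<close> as an element of \<open>B\<close>,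
      \<open>f\<close> fixes it as an element of \<open>N\<close>, and \<open>e \<otimes> f\<close>
      vanishes because \<open>f\<close> itself lies in \<open>N\<close>.\<close>
    have "n = (n \<otimes> e) \<otimes> f" using n f e c by simp
    also have "\<dots> = \<zero>" using c ec by (simp add: m_assoc)
    finally show ?thesis .
  qed
  have left: "e \<otimes> b = b" if b: "b \<in> B" for b
  proof -
    have c: "b \<in> carrier R" "e \<otimes> b \<in> B" using b BD ec by auto
    have "e \<otimes> (e \<otimes> b) = e \<otimes> b" using e c ec by (metis m_assoc)
    then have "b \<ominus> e \<otimes> b \<in> N"
      using b c ec BD by (auto simp: N_def minus_mult_distrib)
    then have "b \<ominus> e \<otimes> b = \<zero>" by (rule N0)
    then show ?thesis using c ec by simp
  qed
  have "x \<otimes> e = e \<otimes> x" if x: "x \<in> carrier R" for x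
  proof -
    have "e \<otimes> (x \<otimes> e) = x \<otimes> e" using x e by (intro left B.I_l_closed)
    moreover have "(e \<otimes> x) \<otimes> e = e \<otimes> x" using x e by (simp add: B.I_r_closed)
    ultimately show ?thesis using x ec by (simp add: m_assoc)
  qed
  with e that show ?thesis by blast
qed

text \<open>This passes an identity \<open>y \<otimes> e = y\<close> on to the whole two-sided ideal
  generated by \<open>y\<close>.\<close>

lemma ideal_fixed_by_central:
  assumes e: "e \<in> carrier R" "\<And>x. x \<in> carrier R \<Longrightarrow> x \<otimes> e = e \<otimes> x"
  shows "ideal {z \<in> carrier R. z \<otimes> e = z} R"
proof (rule ideal_if_left_ideal)
  show "left_ideal {z \<in> carrier R. z \<otimes> e = z} R"
    by (rule left_idealI) (use e(1) in \<open>auto simp: l_distr m_assoc\<close>)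
  fix x r assume x: "x \<in> {z \<in> carrier R. z \<otimes> e = z}" and r: "r \<in> carrier R"
  have "(x \<otimes> r) \<otimes> e = x \<otimes> (r \<otimes> e)" using x r e(1) by (auto simp: m_assoc)
  also have "\<dots> = x \<otimes> (e \<otimes> r)" using e(2)[OF r] by simp
  also have "\<dots> = (x \<otimes> e) \<otimes> r" using x r e(1) m_assoc[of x e r] by auto
  finally show "x \<otimes> r \<in> {z \<in> carrier R. z \<otimes> e = z}" using x r by auto
qed

end

section \<open>Left denominator sets\<close>

text \<open>Words grow by one generator on the left, so an induction exposes a single generator, and
  the conditions of the one denominator set containing it can be applied.\<close>

inductive_set gen_monoid :: "('a, 'm) ring_scheme \<Rightarrow> 'a set \<Rightarrow> 'a set" for R X where
  one: "\<one>\<^bsub>R\<^esub> \<in> gen_monoid R X"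
| mult: "x \<in> X \<Longrightarrow> y \<in> gen_monoid R X \<Longrightarrow> x \<otimes>\<^bsub>R\<^esub> y \<in> gen_monoid R X"

context ring begin

lemma gen_monoid_minimal:
  assumes "X \<subseteq> M" "submonoid M R" shows "gen_monoid R X \<subseteq> M"
proof
  fix x assume "x \<in> gen_monoid R X"
  then show "x \<in> M"
    by induction (use assms in \<open>auto intro: submonoid.m_closed submonoid.one_closed\<close>)
qed

lemma gen_monoid_incl: "X \<subseteq> carrier R \<Longrightarrow> X \<subseteq> gen_monoid R X"
proof
  fix x assume "X \<subseteq> carrier R" "x \<in> X"
  then show "x \<in> gen_monoid R X" using gen_monoid.mult[OF _ gen_monoid.one, of x X R] by auto
qed

lemma submonoid_carrier: "submonoid (carrier R) R"
  by (simp add: submonoid_def)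

lemma submonoid_gen_monoid: "X \<subseteq> carrier R \<Longrightarrow> submonoid (gen_monoid R X) R"
proof
  assume X: "X \<subseteq> carrier R"
  then show sub: "gen_monoid R X \<subseteq> carrier R"
    by (rule gen_monoid_minimal) (rule submonoid_carrier)
  show "x \<otimes> y \<in> gen_monoid R X" if "x \<in> gen_monoid R X" "y \<in> gen_monoid R X" for x y
    using that
  proof induction
    case one then show ?case using sub by auto
  next
    case (mult x z)
    moreover have "x \<in> carrier R" "y \<in> carrier R" "z \<in> carrier R" using mult X sub by auto
    ultimately show ?case by (auto simp: m_assoc intro: gen_monoid.mult)
  qed
qed (rule gen_monoid.one)

lemma left_ore_setD:
  assumes "left_ore_set R S"
  shows "S \<subseteq> carrier R" "\<one> \<in> S" "\<And>s t. s \<in> S \<Longrightarrow> t \<in> S \<Longrightarrow> s \<otimes> t \<in> S" "\<zero> \<notin> S" "submonoid S R"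
    "\<And>r s. r \<in> carrier R \<Longrightarrow> s \<in> S \<Longrightarrow> \<exists>t\<in>S. \<exists>q\<in>carrier R. t \<otimes> r = q \<otimes> s"
proof -
  interpret submonoid S R using assms by (simp add: left_ore_set_def)
  show "S \<subseteq> carrier R" "\<one> \<in> S" "\<And>s t. s \<in> S \<Longrightarrow> t \<in> S \<Longrightarrow> s \<otimes> t \<in> S" "\<zero> \<notin> S" "submonoid S R"
    using subset is_submonoid assms by (auto simp: left_ore_set_def)
  fix r s assume "r \<in> carrier R" "s \<in> S"
  then have "{t \<otimes> r | t. t \<in> S} \<inter> {q \<otimes> s | q. q \<in> carrier R} \<noteq> {}"
    using assms unfolding left_ore_set_def by blast
  then show "\<exists>t\<in>S. \<exists>q\<in>carrier R. t \<otimes> r = q \<otimes> s" by auto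
qed

lemma left_ore_setI:
  assumes "submonoid S R" "\<zero> \<notin> S"
    "\<And>r s. r \<in> carrier R \<Longrightarrow> s \<in> S \<Longrightarrow> \<exists>t\<in>S. \<exists>q\<in>carrier R. t \<otimes> r = q \<otimes> s"
  shows "left_ore_set R S"
  unfolding left_ore_set_def
proof (intro conjI ballI assms(1,2))
  fix r s assume "r \<in> carrier R" "s \<in> S"
  then obtain t q where "t \<in> S" "q \<in> carrier R" "t \<otimes> r = q \<otimes> s" using assms(3) by blast
  then show "{t \<otimes> r | t. t \<in> S} \<inter> {q \<otimes> s | q. q \<in> carrier R} \<noteq> {}" by blast
qed

lemma Den_lD:
  assumes "S \<in> Den_l R"
  shows "left_ore_set R S" "\<And>r s. r \<in> carrier R \<Longrightarrow> s \<in> S \<Longrightarrow> r \<otimes> s = \<zero> \<Longrightarrow> \<exists>t\<in>S. t \<otimes> r = \<zero>"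
  using assms unfolding Den_l_def ass_def by blast+

lemma Den_lI:
  assumes "left_ore_set R S" "\<And>r s. r \<in> carrier R \<Longrightarrow> s \<in> S \<Longrightarrow> r \<otimes> s = \<zero> \<Longrightarrow> \<exists>t\<in>S. t \<otimes> r = \<zero>"
  shows "S \<in> Den_l R"
  using assms unfolding Den_l_def ass_def by blast+

text \<open>The Ore and denominator conditions pass from generators to words one factor at a time;
  only the exclusion of zero can fail. This one fact handles unions of chains, \<open>T_l\<close>,
  \<open>S_l_0\<close> and the join of \<open>\<C> R\<close> with a maximal set.\<close>

lemma gen_monoid_Den_l:
  assumes F: "F \<subseteq> Den_l R" and z: "\<zero> \<notin> gen_monoid R (\<Union> F)"
  shows "gen_monoid R (\<Union> F) \<in> Den_l R"
proof -
  let ?G = "gen_monoid R (\<Union> F)"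
  have X: "\<Union> F \<subseteq> carrier R" using F left_ore_setD(1)[OF Den_lD(1)] by blast
  note incl = gen_monoid_incl[OF X]
  interpret G: submonoid ?G R by (rule submonoid_gen_monoid[OF X])
  note G = subsetD[OF G.subset]
  have ore: "\<exists>t\<in>?G. \<exists>q\<in>carrier R. t \<otimes> r = q \<otimes> s" if "s \<in> ?G" "r \<in> carrier R" for s r
    using that
  proof (induction arbitrary: r)
    case one
    then show ?case by (intro bexI[of _ \<one>] bexI[of _ r]) (auto intro: gen_monoid.one)
  next
    case (mult x y)
    \<comment> \<open>The multiplier is found from the right: first \<open>y\<close> by induction,
      then \<open>x\<close> against the resulting \<open>q\<close> inside the set \<open>S\<close>
      that contains \<open>x\<close>.\<close>
    obtain t q where t: "t \<in> ?G" "q \<in> carrier R" "t \<otimes> r = q \<otimes> y"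
      using mult by blast
    obtain S where S: "S \<in> F" "x \<in> S" using mult by blast
    then obtain t' q' where t': "t' \<in> S" "q' \<in> carrier R" "t' \<otimes> q = q' \<otimes> x"
      using left_ore_setD(6)[OF Den_lD(1), of S q x] F t by blast
    have tG: "t' \<in> ?G" "x \<in> ?G" using incl S t' by auto
    have "(t' \<otimes> t) \<otimes> r = (t' \<otimes> q) \<otimes> y"
      using tG t mult G by (simp add: m_assoc)
    also have "\<dots> = q' \<otimes> (x \<otimes> y)"
      using t' tG mult G by (simp add: m_assoc)
    finally show ?case using t' tG t by blast
  qed
  have den: "\<exists>t\<in>?G. t \<otimes> r = \<zero>" if "s \<in> ?G" "r \<in> carrier R" "r \<otimes> s = \<zero>" for s r
    using that
  proof (induction arbitrary: r)
    case one
    then show ?case by (auto intro!: bexI[of _ \<one>] gen_monoid.one)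
  next
    case (mult x y)
    obtain S where S: "S \<in> F" "x \<in> S" using mult by blast
    have xG: "x \<in> ?G" using incl S by auto
    \<comment> \<open>The induction hypothesis for \<open>r \<otimes> x\<close> removes
      \<open>y\<close>; the denominator condition of \<open>S\<close> then removes \<open>x\<close>
      from \<open>(t \<otimes> r) \<otimes> x = \<zero>\<close>.\<close>
    obtain t where t: "t \<in> ?G" "t \<otimes> (r \<otimes> x) = \<zero>"
      using mult.IH[of "r \<otimes> x"] mult.prems mult.hyps xG G by (auto simp: m_assoc)
    then obtain t' where t': "t' \<in> S" "t' \<otimes> (t \<otimes> r) = \<zero>"
      using Den_lD(2)[of S "t \<otimes> r" x] S F mult.prems xG G by (auto simp: m_assoc)
    have "t' \<in> ?G" using incl S t' by auto
    then show ?case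
      using t t' mult.prems G by (intro bexI[of _ "t' \<otimes> t"]) (auto simp: m_assoc)
  qed
  show ?thesis
    using ore den z by (intro Den_lI left_ore_setI G.is_submonoid) auto
qed

section \<open>Maximal denominator sets, their intersection and \<open>T_l\<close>\<close>

text \<open>Zorn's lemma applies because the union of a nonempty chain is a submonoid, hence equals
  the monoid it generates, and zero lies in no member.\<close>

lemma ex_max_Den_l:
  assumes "S \<in> Den_l R"
  obtains M where "M \<in> max_Den_l R" "S \<subseteq> M"
proof -
  define A where "A = {M \<in> Den_l R. S \<subseteq> M}"
  have "\<Union> C \<in> A" if C: "C \<noteq> {}" "subset.chain A C" for C
  proof -
    have CD: "C \<subseteq> Den_l R" "\<And>M. M \<in> C \<Longrightarrow> S \<subseteq> M"
      and tot: "\<And>M N. M \<in> C \<Longrightarrow> N \<in> C \<Longrightarrow> M \<subseteq> N \<or> N \<subseteq> M"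
      using C(2) by (auto simp: A_def subset_chain_def)
    note ore = left_ore_setD[OF Den_lD(1)[OF subsetD[OF CD(1)]]]
    have sub: "submonoid (\<Union> C) R"
    proof
      show "x \<otimes> y \<in> \<Union> C" if xy: "x \<in> \<Union> C" "y \<in> \<Union> C" for x y
      proof -
        obtain M N where "M \<in> C" "x \<in> M" "N \<in> C" "y \<in> N" using xy by blast
        then obtain K where "K \<in> C" "x \<in> K" "y \<in> K" using tot by blast
        then show ?thesis using ore(3) by blast
      qed
    qed (use C(1) ore(1,2) in \<open>blast+\<close>)
    then have eq: "gen_monoid R (\<Union> C) = \<Union> C"
      by (intro equalityI gen_monoid_minimal gen_monoid_incl submonoid.subset) auto
    have "\<Union> C \<in> Den_l R"
      using gen_monoid_Den_l[OF CD(1)] ore(4) by (auto simp: eq)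
    then show ?thesis using C(1) CD(2) by (auto simp: A_def)
  qed
  moreover have "A \<noteq> {}" using assms by (auto simp: A_def)
  ultimately obtain M where "M \<in> A" "\<forall>N\<in>A. M \<subseteq> N \<longrightarrow> N = M"
    using subset_Zorn_nonempty[of A] by metis
  then show ?thesis
    using that[of M] by (auto simp: A_def max_Den_l_def)
qed

lemma one_Den_l:
  assumes "\<one> \<noteq> \<zero>" shows "{\<one>} \<in> Den_l R"
proof (intro Den_lI left_ore_setI)
  show "submonoid {\<one>} R" by (simp add: submonoid_def)
  show "\<zero> \<notin> {\<one>}" using assms by simp
  show "\<exists>t\<in>{\<one>}. \<exists>q\<in>carrier R. t \<otimes> r = q \<otimes> s" if "r \<in> carrier R" "s \<in> {\<one>}" for r s
    using that by simp
  show "\<exists>t\<in>{\<one>}. t \<otimes> r = \<zero>" if "r \<in> carrier R" "s \<in> {\<one>}" "r \<otimes> s = \<zero>" for r s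
    using that by simp
qed

lemma strong_l_submonoid:
  assumes "\<one> \<noteq> \<zero>" shows "submonoid (\<L>\<^sup>s\<^sub>l R) R" "\<zero> \<notin> \<L>\<^sup>s\<^sub>l R"
proof -
  have ore: "left_ore_set R M" if "M \<in> max_Den_l R" for M
    using that by (simp add: max_Den_l_def Den_lD(1))
  \<comment> \<open>Some maximal set must exist, since the intersection of an empty family would be
    \<open>UNIV\<close>.\<close>
  obtain M where "M \<in> max_Den_l R" using ex_max_Den_l[OF one_Den_l[OF assms]] by blast
  then show "submonoid (\<L>\<^sup>s\<^sub>l R) R" "\<zero> \<notin> \<L>\<^sup>s\<^sub>l R"
    using left_ore_setD(1-4)[OF ore] unfolding strong_l_def submonoid_def by blast+
qed

text \<open>The monoid generated by the competing sets stays inside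
  \<open>\<L>\<^sup>s\<^sub>l R\<close>, which is a submonoid without zero. It is therefore itself a
  competitor, and so equals their union.\<close>

lemma T_l_Den_l:
  assumes "\<one> \<noteq> \<zero>" shows "T_l R \<in> Den_l R"
proof -
  define F where "F = {S \<in> Den_l R. S \<subseteq> \<L>\<^sup>s\<^sub>l R}"
  have le: "gen_monoid R (\<Union> F) \<subseteq> \<L>\<^sup>s\<^sub>l R"
    by (rule gen_monoid_minimal) (use strong_l_submonoid[OF assms] in \<open>auto simp: F_def\<close>)
  then have "gen_monoid R (\<Union> F) \<in> Den_l R"
    using strong_l_submonoid(2)[OF assms] by (intro gen_monoid_Den_l) (auto simp: F_def)
  moreover from this le have "gen_monoid R (\<Union> F) = \<Union> F"
    using submonoid.subset[OF strong_l_submonoid(1)[OF assms]]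
    by (intro equalityI gen_monoid_incl) (auto simp: F_def)
  ultimately show ?thesis by (simp add: T_l_def F_def)
qed

section \<open>Regular elements and \<open>S_l_0\<close>\<close>

lemma regular_elementsD:
  assumes "c \<in> \<C> R"
  shows "c \<in> carrier R" "\<And>x. x \<in> carrier R \<Longrightarrow> c \<otimes> x = \<zero> \<Longrightarrow> x = \<zero>"
    "\<And>x. x \<in> carrier R \<Longrightarrow> x \<otimes> c = \<zero> \<Longrightarrow> x = \<zero>"
proof -
  have *: "c \<in> carrier R \<and> (\<forall>x\<in>carrier R. (c \<otimes> x = \<zero> \<longrightarrow> x = \<zero>) \<and> (x \<otimes> c = \<zero> \<longrightarrow> x = \<zero>))"
    using assms unfolding regular_elements_def by (rule CollectD)
  show "c \<in> carrier R" using * by (rule conjunct1)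
  show "x = \<zero>" if "x \<in> carrier R" "c \<otimes> x = \<zero>" for x
    using bspec[OF conjunct2[OF *] that(1)] that(2) by (elim conjE) (rule mp)
  show "x = \<zero>" if "x \<in> carrier R" "x \<otimes> c = \<zero>" for x
    using bspec[OF conjunct2[OF *] that(1)] that(2) by (elim conjE) (rule mp)
qed

lemma regular_elementsI:
  assumes "c \<in> carrier R" "\<And>x. x \<in> carrier R \<Longrightarrow> c \<otimes> x = \<zero> \<Longrightarrow> x = \<zero>"
    "\<And>x. x \<in> carrier R \<Longrightarrow> x \<otimes> c = \<zero> \<Longrightarrow> x = \<zero>"
  shows "c \<in> \<C> R"
  unfolding regular_elements_def using assms by (intro CollectI conjI ballI impI) assumption+

lemma regular_elements_submonoid: "submonoid (\<C> R) R"
proof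
  show "\<C> R \<subseteq> carrier R" using regular_elementsD(1) by blast
  show "\<one> \<in> \<C> R" by (rule regular_elementsI) auto
  show "x \<otimes> y \<in> \<C> R" if x: "x \<in> \<C> R" and y: "y \<in> \<C> R" for x y
  proof (rule regular_elementsI)
    note c = regular_elementsD(1)[OF x] regular_elementsD(1)[OF y]
    show "x \<otimes> y \<in> carrier R" using c by simp
    show "z = \<zero>" if z: "z \<in> carrier R" "(x \<otimes> y) \<otimes> z = \<zero>" for z
    proof (rule regular_elementsD(2)[OF y z(1)], rule regular_elementsD(2)[OF x])
      show "y \<otimes> z \<in> carrier R" "x \<otimes> (y \<otimes> z) = \<zero>" using z c by (simp_all add: m_assoc)
    qed
    show "z = \<zero>" if z: "z \<in> carrier R" "z \<otimes> (x \<otimes> y) = \<zero>" for z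
    proof (rule regular_elementsD(3)[OF x z(1)], rule regular_elementsD(3)[OF y])
      show "z \<otimes> x \<in> carrier R" "(z \<otimes> x) \<otimes> y = \<zero>" using z c by (simp_all add: m_assoc)
    qed
  qed
qed

text \<open>Zero \<open>ass\<close> excludes \<open>s \<otimes> r = \<zero>\<close> directly and
  \<open>r \<otimes> s = \<zero>\<close> through the denominator condition. This replaces the
  predicate in \<open>S_l_0_def\<close> by one that is easy to check on generated monoids.\<close>

lemma Den_l_ass_zero_iff:
  "S \<in> Den_l R \<and> ass R S = {\<zero>} \<longleftrightarrow> left_ore_set R S \<and> S \<subseteq> \<C> R"
proof
  assume S: "S \<in> Den_l R \<and> ass R S = {\<zero>}"
  then have ore: "left_ore_set R S" using Den_lD(1) by blast
  have l: "r = \<zero>" if "r \<in> carrier R" "s \<in> S" "s \<otimes> r = \<zero>" for r s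
    using S that unfolding ass_def by blast
  have "r = \<zero>" if "r \<in> carrier R" "s \<in> S" "r \<otimes> s = \<zero>" for r s
    using Den_lD(2)[OF conjunct1[OF S] that] l[OF that(1)] by blast
  then have "S \<subseteq> \<C> R"
    using left_ore_setD(1)[OF ore] l by (blast intro: regular_elementsI)
  with ore show "left_ore_set R S \<and> S \<subseteq> \<C> R" by blast
next
  assume S: "left_ore_set R S \<and> S \<subseteq> \<C> R"
  then have ore: "left_ore_set R S" and one: "\<one> \<in> S" using left_ore_setD(2) by blast+
  have "\<exists>t\<in>S. t \<otimes> r = \<zero>" if "r \<in> carrier R" "s \<in> S" "r \<otimes> s = \<zero>" for r s
    using regular_elementsD(3)[of s r] S that one by (intro bexI[of _ \<one>]) auto
  then have "S \<in> Den_l R" using ore by (intro Den_lI)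
  moreover have "ass R S = {\<zero>}"
  proof
    show "ass R S \<subseteq> {\<zero>}"
    proof
      fix r assume "r \<in> ass R S"
      then obtain s where "s \<in> S" "r \<in> carrier R" "s \<otimes> r = \<zero>" by (auto simp: ass_def)
      then show "r \<in> {\<zero>}" using regular_elementsD(2)[of s r] S by auto
    qed
    show "{\<zero>} \<subseteq> ass R S" using one by (auto simp: ass_def intro!: bexI[of _ \<one>])
  qed
  ultimately show "S \<in> Den_l R \<and> ass R S = {\<zero>}" ..
qed

text \<open>The left Ore sets of regular elements generate a monoid that is again regular, so it
  avoids zero and is the greatest of them. This justifies the use of \<open>GREATEST\<close> in the
  definition.\<close>

lemma S_l_0_greatest:
  assumes "\<one> \<noteq> \<zero>"
  shows "left_ore_set R (S_l_0 R)" "S_l_0 R \<subseteq> \<C> R"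
    "\<And>S. left_ore_set R S \<Longrightarrow> S \<subseteq> \<C> R \<Longrightarrow> S \<subseteq> S_l_0 R"
proof -
  define F where "F = {S. left_ore_set R S \<and> S \<subseteq> \<C> R}"
  let ?G = "gen_monoid R (\<Union> F)"
  have F: "F \<subseteq> Den_l R" using Den_l_ass_zero_iff by (auto simp: F_def)
  have le: "?G \<subseteq> \<C> R"
    by (rule gen_monoid_minimal) (use regular_elements_submonoid in \<open>auto simp: F_def\<close>)
  moreover have "\<zero> \<notin> \<C> R" using assms by (auto simp: regular_elements_def)
  ultimately have "?G \<in> Den_l R" using F by (intro gen_monoid_Den_l) auto
  then have G: "left_ore_set R ?G \<and> ?G \<subseteq> \<C> R" using le by (auto simp: Den_lD(1))
  have max: "S \<subseteq> ?G" if "left_ore_set R S \<and> S \<subseteq> \<C> R" for S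
    using that gen_monoid_incl[of "\<Union> F"] by (auto simp: F_def regular_elements_def)
  have "S_l_0 R = ?G"
    unfolding S_l_0_def Den_l_ass_zero_iff by (rule Greatest_equality) (use G max in auto)
  with G max show "left_ore_set R (S_l_0 R)" "S_l_0 R \<subseteq> \<C> R"
    "\<And>S. left_ore_set R S \<Longrightarrow> S \<subseteq> \<C> R \<Longrightarrow> S \<subseteq> S_l_0 R" by auto
qed

end

section \<open>Localization at regular elements\<close>

text \<open>Each of the three conditions of the theorem concerns a localization at regular elements.
  There denominators cancel on both sides and \<open>R\<close> embeds in the localization.\<close>

locale regular_ore_set = ring +
  fixes S
  assumes ore_set: "left_ore_set R S" and regular: "S \<subseteq> \<C> R"
begin

lemmas S_one = left_ore_setD(2)[OF ore_set]
  and S_mult = left_ore_setD(3)[OF ore_set]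
  and S_ore = left_ore_setD(6)[OF ore_set]

lemma S_carrier: "s \<in> S \<Longrightarrow> s \<in> carrier R"
  using left_ore_setD(1)[OF ore_set] by blast

lemma S_lcancel:
  assumes "s \<in> S" "x \<in> carrier R" "y \<in> carrier R" "s \<otimes> x = s \<otimes> y"
  shows "x = y"
proof -
  have s: "s \<in> \<C> R" "s \<in> carrier R" using assms(1) regular S_carrier by auto
  have "s \<otimes> (x \<ominus> y) = \<zero>"
    using s(2) assms(2-3) by (simp add: minus_mult_distrib(2) assms(4))
  then have "x \<ominus> y = \<zero>"
    by (rule regular_elementsD(2)[OF s(1), rotated]) (simp add: assms(2,3))
  then show ?thesis using assms(2,3) by simp
qed

lemma S_rcancel:
  assumes "s \<in> S" "x \<in> carrier R" "y \<in> carrier R" "x \<otimes> s = y \<otimes> s"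
  shows "x = y"
  by (rule m_rcancel_if[OF regular_elementsD(3)[OF subsetD[OF regular assms(1)]]
        S_carrier[OF assms(1)] assms(2-4)])

text \<open>Equality of fractions is witnessed by one pair of multipliers but holds for every pair
  with \<open>x \<otimes> s = y \<otimes> t\<close>. The Ore condition gives both pairs a common
  multiple, where cancelling \<open>s\<close> and \<open>t\<close> identifies the multipliers;
  finally \<open>w\<close> is cancelled. Transitivity and independence of representatives rest on
  this.\<close>

lemma ore_rel_eq_if:
  assumes "((s, r), (t, q)) \<in> ore_rel R S"
    and x: "x \<in> carrier R" and y: "y \<in> carrier R" and xy: "x \<otimes> s = y \<otimes> t"
  shows "x \<otimes> r = y \<otimes> q"
proof -
  obtain c d where c: "s \<in> carrier R" "r \<in> carrier R" "t \<in> S" "t \<in> carrier R" "q \<in> carrier R"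
    "c \<in> carrier R" "d \<in> carrier R" "c \<otimes> s = d \<otimes> t" "c \<otimes> s \<in> S" "c \<otimes> r = d \<otimes> q" "s \<in> S"
    using assms(1) S_carrier unfolding ore_rel_def by blast
  obtain w z where w: "w \<in> S" "z \<in> carrier R" "w \<otimes> (x \<otimes> s) = z \<otimes> (c \<otimes> s)"
    using S_ore[of "x \<otimes> s" "c \<otimes> s"] x c by auto
  note wc = S_carrier[OF w(1)]
  have "(w \<otimes> x) \<otimes> s = (z \<otimes> c) \<otimes> s"
    using w wc x c(1,6) by (simp add: m_assoc)
  then have 1: "w \<otimes> x = z \<otimes> c"
    by (rule S_rcancel[OF c(11), rotated -1]) (use w wc x c in auto)
  have "(w \<otimes> y) \<otimes> t = w \<otimes> (x \<otimes> s)" using wc y c(4) by (simp add: m_assoc xy)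
  also have "\<dots> = (z \<otimes> d) \<otimes> t" using w(2) c(4,7) by (simp add: m_assoc w(3) c(8))
  finally have 2: "w \<otimes> y = z \<otimes> d"
    by (rule S_rcancel[OF c(3), rotated -1]) (use w wc y c in auto)
  have "w \<otimes> (x \<otimes> r) = (z \<otimes> c) \<otimes> r"
    using m_assoc[OF wc x c(2)] 1 by simp
  also have "\<dots> = z \<otimes> (d \<otimes> q)" using w(2) c(2,6) by (simp add: m_assoc c(10))
  also have "\<dots> = (w \<otimes> y) \<otimes> q" using m_assoc[OF w(2) c(7) c(5)] 2 by simp
  also have "\<dots> = w \<otimes> (y \<otimes> q)" using wc y c(5) by (simp add: m_assoc)
  finally show ?thesis
    by (rule S_lcancel[OF w(1), rotated -1]) (use x y c in auto)
qed

lemma ore_relI: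
  assumes "s \<in> S" "r \<in> carrier R" "t \<in> S" "q \<in> carrier R" "a \<in> carrier R" "b \<in> carrier R"
    "a \<otimes> s = b \<otimes> t" "a \<otimes> s \<in> S" "a \<otimes> r = b \<otimes> q"
  shows "((s, r), (t, q)) \<in> ore_rel R S"
  using assms unfolding ore_rel_def by blast

lemma ore_rel_equiv: "equiv (S \<times> carrier R) (ore_rel R S)"
proof (rule equivI)
  show "ore_rel R S \<subseteq> (S \<times> carrier R) \<times> S \<times> carrier R" by (auto simp: ore_rel_def)
  show "refl_on (S \<times> carrier R) (ore_rel R S)"
    by (rule refl_onI) (auto simp: S_carrier intro!: ore_relI[of _ _ _ _ \<one> \<one>])
  show "sym (ore_rel R S)"
  proof (rule symI, clarify)
    fix s r t q assume "((s, r), (t, q)) \<in> ore_rel R S"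
    then obtain a b where "s \<in> S" "r \<in> carrier R" "t \<in> S" "q \<in> carrier R" "a \<in> carrier R"
      "b \<in> carrier R" "a \<otimes> s = b \<otimes> t" "a \<otimes> s \<in> S" "a \<otimes> r = b \<otimes> q"
      unfolding ore_rel_def by blast
    then show "((t, q), (s, r)) \<in> ore_rel R S" by (intro ore_relI[of _ _ _ _ b a]) simp_all
  qed
  show "trans (ore_rel R S)"
  proof (rule transI, clarify)
    fix s r t q v p
    assume 1: "((s, r), (t, q)) \<in> ore_rel R S" and 2: "((t, q), (v, p)) \<in> ore_rel R S"
    obtain a b where a: "s \<in> S" "r \<in> carrier R" "t \<in> S" "q \<in> carrier R" "a \<in> carrier R"
      "b \<in> carrier R" "a \<otimes> s = b \<otimes> t" "a \<otimes> s \<in> S" "a \<otimes> r = b \<otimes> q"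
      using 1 unfolding ore_rel_def by blast
    obtain c d where c: "v \<in> S" "p \<in> carrier R" "c \<in> carrier R"
      "d \<in> carrier R" "c \<otimes> t = d \<otimes> v" "c \<otimes> t \<in> S"
      using 2 unfolding ore_rel_def by blast
    \<comment> \<open>A common multiple of the two common denominators, with \<open>u\<close> in
      \<open>S\<close> so that the new denominator stays in \<open>S\<close>. The multipliers
      \<open>u \<otimes> b\<close> and \<open>x \<otimes> d\<close> need not be witnesses of the
      second relation, hence \<open>ore_rel_eq_if\<close>.\<close>
    obtain u x where u: "u \<in> S" "x \<in> carrier R" "u \<otimes> (a \<otimes> s) = x \<otimes> (c \<otimes> t)"
      using S_ore[of "a \<otimes> s" "c \<otimes> t"] a(1,5) c(6) S_carrier by auto
    note uc = S_carrier[OF u(1)] and ac = S_carrier[OF a(1)] S_carrier[OF a(3)] S_carrier[OF c(1)]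
    have "(u \<otimes> b) \<otimes> t = (x \<otimes> d) \<otimes> v"
      using u(3) uc u(2) a(6) c(4) ac by (simp add: m_assoc a(7) c(5))
    then have q: "(u \<otimes> b) \<otimes> q = (x \<otimes> d) \<otimes> p"
      by (rule ore_rel_eq_if[OF 2, rotated -1]) (use uc u(2) a(6) c(4) in auto)
    show "((s, r), (v, p)) \<in> ore_rel R S"
    proof (rule ore_relI[OF a(1,2) c(1,2), of "u \<otimes> a" "x \<otimes> d"])
      have *: "(u \<otimes> a) \<otimes> s = u \<otimes> (a \<otimes> s)" using uc a(5) ac by (simp add: m_assoc)
      then show "(u \<otimes> a) \<otimes> s \<in> S" using S_mult[OF u(1) a(8)] by simp
      show "(u \<otimes> a) \<otimes> s = (x \<otimes> d) \<otimes> v"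
        unfolding * u(3) c(5) using u(2) c(4) ac by (simp add: m_assoc)
      have "(u \<otimes> a) \<otimes> r = (u \<otimes> b) \<otimes> q"
        using uc a(2,4,5,6) by (simp add: m_assoc a(9))
      with q show "(u \<otimes> a) \<otimes> r = (x \<otimes> d) \<otimes> p" by simp
    qed (use uc a(5) u(2) c(4) in auto)
  qed
qed

lemma left_frac_eqI:
  assumes "((s, r), (t, q)) \<in> ore_rel R S" shows "left_frac R S s r = left_frac R S t q"
  unfolding left_frac_def by (rule equiv_class_eq[OF ore_rel_equiv assms])

lemma left_frac_eq_iff:
  assumes "s \<in> S" "r \<in> carrier R" "t \<in> S" "q \<in> carrier R"
  shows "left_frac R S s r = left_frac R S t q \<longleftrightarrow> ((s, r), (t, q)) \<in> ore_rel R S"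
  unfolding left_frac_def using eq_equiv_class_iff[OF ore_rel_equiv] assms by auto

lemma left_frac_self: "s \<in> S \<Longrightarrow> r \<in> carrier R \<Longrightarrow> (s, r) \<in> left_frac R S s r"
  unfolding left_frac_def using equiv_class_self[OF ore_rel_equiv] by auto

lemma left_fracD: "(s', r') \<in> left_frac R S s r \<Longrightarrow> ((s, r), (s', r')) \<in> ore_rel R S"
  by (simp add: left_frac_def)

text \<open>The Ore condition supplies one common multiple of the denominators, but not a prescribed
  one; therefore \<open>eq\<close> is asked for all of them.\<close>

lemma left_frac_eq_of_ore:
  assumes d: "d \<in> S" "d' \<in> S" and n: "n \<in> carrier R" "n' \<in> carrier R"
    and eq: "\<And>x y. x \<in> S \<Longrightarrow> y \<in> carrier R \<Longrightarrow> x \<otimes> d = y \<otimes> d' \<Longrightarrow> x \<otimes> n = y \<otimes> n'"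
  shows "left_frac R S d n = left_frac R S d' n'"
proof -
  obtain x y where x: "x \<in> S" "y \<in> carrier R" "x \<otimes> d = y \<otimes> d'"
    using S_ore[OF S_carrier[OF d(1)] d(2)] by blast
  show ?thesis
    by (rule left_frac_eqI, rule ore_relI[OF d(1) n(1) d(2) n(2) S_carrier[OF x(1)] x(2,3)])
      (use eq[OF x] S_mult[OF x(1) d(1)] in auto)
qed

section \<open>Arithmetic of left fractions\<close>

text \<open>All choices of representatives and multipliers give the same class, so the union in the
  definition is over a singleton.\<close>

lemma mult_left_frac:
  assumes s: "s \<in> S" and r: "r \<in> carrier R" and t: "t \<in> S" and q: "q \<in> carrier R"
    and u: "u \<in> S" and a: "a \<in> carrier R" and ur: "u \<otimes> r = a \<otimes> t"
  shows "left_frac R S s r \<otimes>\<^bsub>left_localization R S\<^esub> left_frac R S t q =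
    left_frac R S (u \<otimes> s) (a \<otimes> q)"
proof -
  let ?x = "left_frac R S (u \<otimes> s) (a \<otimes> q)"
  let ?A = "{left_frac R S (u' \<otimes> s') (a' \<otimes> q') | s' r' t' q' u' a'.
       (s', r') \<in> left_frac R S s r \<and> (t', q') \<in> left_frac R S t q \<and> u' \<in> S \<and> a' \<in> carrier R \<and>
       u' \<otimes> r' = a' \<otimes> t'}"
  have eq: "?x = left_frac R S (u' \<otimes> s') (a' \<otimes> q')"
    if "(s', r') \<in> left_frac R S s r" "(t', q') \<in> left_frac R S t q"
      "u' \<in> S" "a' \<in> carrier R" "u' \<otimes> r' = a' \<otimes> t'" for s' r' t' q' u' a'
  proof -
    note rel = left_fracD[OF that(1)] left_fracD[OF that(2)]
    have c: "s' \<in> S" "r' \<in> carrier R" "t' \<in> S" "q' \<in> carrier R"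
      using rel by (auto simp: ore_rel_def)
    note cc = S_carrier[OF s] S_carrier[OF t] S_carrier[OF u] S_carrier[OF c(1)] S_carrier[OF c(3)]
      S_carrier[OF that(3)]
    show ?thesis
    proof (rule left_frac_eq_of_ore)
      fix x y assume x: "x \<in> S" "y \<in> carrier R" "x \<otimes> (u \<otimes> s) = y \<otimes> (u' \<otimes> s')"
      note xc = S_carrier[OF x(1)]
      \<comment> \<open>The first relation turns equal denominators into equal multiples of
        \<open>r\<close> and \<open>r'\<close>. By the choice of \<open>a\<close> and
        \<open>a'\<close> these are multiples of \<open>t\<close> and \<open>t'\<close>, to which
        the second relation applies.\<close>
      have "(x \<otimes> u) \<otimes> s = (y \<otimes> u') \<otimes> s'"
        using x(2,3) xc cc by (simp add: m_assoc)
      then have "(x \<otimes> u) \<otimes> r = (y \<otimes> u') \<otimes> r'"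
        by (rule ore_rel_eq_if[OF rel(1), rotated -1]) (use x(2) xc cc in auto)
      then have "(x \<otimes> a) \<otimes> t = (y \<otimes> a') \<otimes> t'"
        using x(2) xc cc a that(4) r c(2) by (simp add: m_assoc ur that(5))
      then have "(x \<otimes> a) \<otimes> q = (y \<otimes> a') \<otimes> q'"
        by (rule ore_rel_eq_if[OF rel(2), rotated -1]) (use x(2) xc a that(4) in auto)
      then show "x \<otimes> (a \<otimes> q) = y \<otimes> (a' \<otimes> q')"
        using x(2) xc a that(4) q c(4) by (simp add: m_assoc)
    qed (use S_mult u s c that a q in auto)
  qed
  have "?x \<in> ?A" using left_frac_self[OF s r] left_frac_self[OF t q] u a ur by blast
  moreover have "z = ?x" if "z \<in> ?A" for z
    using that by (elim CollectE exE conjE) (simp add: eq)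
  ultimately have "?A = {?x}" by blast
  then have "\<Union> ?A = ?x" by simp
  then show ?thesis by (simp add: left_localization_def)
qed

lemma add_left_frac:
  assumes s: "s \<in> S" and r: "r \<in> carrier R" and t: "t \<in> S" and q: "q \<in> carrier R"
    and a: "a \<in> carrier R" and b: "b \<in> carrier R" and as: "a \<otimes> s = b \<otimes> t" "a \<otimes> s \<in> S"
  shows "left_frac R S s r \<oplus>\<^bsub>left_localization R S\<^esub> left_frac R S t q =
    left_frac R S (a \<otimes> s) (a \<otimes> r \<oplus> b \<otimes> q)"
proof -
  let ?x = "left_frac R S (a \<otimes> s) (a \<otimes> r \<oplus> b \<otimes> q)"
  let ?A = "{left_frac R S (a' \<otimes> s') (a' \<otimes> r' \<oplus> b' \<otimes> q') | s' r' t' q' a' b'.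
       (s', r') \<in> left_frac R S s r \<and> (t', q') \<in> left_frac R S t q \<and> a' \<in> carrier R \<and>
       b' \<in> carrier R \<and> a' \<otimes> s' = b' \<otimes> t' \<and> a' \<otimes> s' \<in> S}"
  have eq: "?x = left_frac R S (a' \<otimes> s') (a' \<otimes> r' \<oplus> b' \<otimes> q')"
    if "(s', r') \<in> left_frac R S s r" "(t', q') \<in> left_frac R S t q"
      "a' \<in> carrier R" "b' \<in> carrier R" "a' \<otimes> s' = b' \<otimes> t'" "a' \<otimes> s' \<in> S" for s' r' t' q' a' b'
  proof -
    note rel = left_fracD[OF that(1)] left_fracD[OF that(2)]
    have c: "s' \<in> S" "r' \<in> carrier R" "t' \<in> S" "q' \<in> carrier R"
      using rel by (auto simp: ore_rel_def)
    note cc = S_carrier[OF s] S_carrier[OF t] S_carrier[OF c(1)] S_carrier[OF c(3)]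
    show ?thesis
    proof (rule left_frac_eq_of_ore)
      fix x y assume x: "x \<in> S" "y \<in> carrier R" "x \<otimes> (a \<otimes> s) = y \<otimes> (a' \<otimes> s')"
      note xc = S_carrier[OF x(1)]
      have "(x \<otimes> a) \<otimes> s = (y \<otimes> a') \<otimes> s'"
        using x(2,3) xc cc a that(3) by (simp add: m_assoc)
      then have 1: "(x \<otimes> a) \<otimes> r = (y \<otimes> a') \<otimes> r'"
        by (rule ore_rel_eq_if[OF rel(1), rotated -1]) (use x(2) xc a that(3) in auto)
      have "(x \<otimes> b) \<otimes> t = x \<otimes> (a \<otimes> s)" using xc b cc by (simp add: m_assoc as(1))
      also have "\<dots> = (y \<otimes> b') \<otimes> t'"
        unfolding x(3) using x(2) that(4) cc by (simp add: m_assoc that(5))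
      finally have 2: "(x \<otimes> b) \<otimes> q = (y \<otimes> b') \<otimes> q'"
        by (rule ore_rel_eq_if[OF rel(2), rotated -1]) (use x(2) xc b that(4) in auto)
      show "x \<otimes> (a \<otimes> r \<oplus> b \<otimes> q) = y \<otimes> (a' \<otimes> r' \<oplus> b' \<otimes> q')"
        using 1 2 x(2) xc a b that(3,4) r q c(2,4) by (simp add: m_assoc r_distr)
    qed (use as that c a b r q in auto)
  qed
  have "?x \<in> ?A" using left_frac_self[OF s r] left_frac_self[OF t q] a b as by blast
  moreover have "z = ?x" if "z \<in> ?A" for z
    using that by (elim CollectE exE conjE) (simp add: eq)
  ultimately have "?A = {?x}" by blast
  then have "\<Union> ?A = ?x" by simp
  then show ?thesis by (simp add: left_localization_def)
qed

section \<open>The canonical map into the localization\<close>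

lemma left_frac_one_hom: "left_frac R S \<one> \<in> ring_hom R (left_localization R S)"
proof (rule ring_hom_memI)
  fix x y assume xy: "x \<in> carrier R" "y \<in> carrier R"
  show "left_frac R S \<one> x \<in> carrier (left_localization R S)"
    using xy S_one by (auto simp: left_localization_def left_frac_def intro: quotientI)
  show "left_frac R S \<one> (x \<otimes> y) =
      left_frac R S \<one> x \<otimes>\<^bsub>left_localization R S\<^esub> left_frac R S \<one> y"
    using mult_left_frac[OF S_one xy(1) S_one xy(2) S_one xy(1)] xy by simp
  show "left_frac R S \<one> (x \<oplus> y) =
      left_frac R S \<one> x \<oplus>\<^bsub>left_localization R S\<^esub> left_frac R S \<one> y"
    using add_left_frac[OF S_one xy(1) S_one xy(2) one_closed one_closed] xy S_one by simp
qed (simp add: left_localization_def)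

lemma left_frac_one_inj: "inj_on (left_frac R S \<one>) (carrier R)"
proof (rule inj_onI)
  fix x y assume xy: "x \<in> carrier R" "y \<in> carrier R" "left_frac R S \<one> x = left_frac R S \<one> y"
  then have "((\<one>, x), (\<one>, y)) \<in> ore_rel R S"
    using left_frac_eq_iff[OF S_one xy(1) S_one xy(2)] by simp
  then show "x = y"
    using ore_rel_eq_if[of \<one> x \<one> y \<one> \<one>] xy by simp
qed

lemma left_frac_clear_denominator:
  assumes s: "s \<in> S" and r: "r \<in> carrier R"
  shows "left_frac R S \<one> s \<otimes>\<^bsub>left_localization R S\<^esub> left_frac R S s r = left_frac R S \<one> r"
  using mult_left_frac[OF S_one S_carrier[OF s] s r S_one one_closed] s r S_carrier[OF s] by simp

lemma left_frac_one_Units: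
  assumes s: "s \<in> S"
  shows "left_frac R S \<one> s \<in> Units (left_localization R S)"
proof -
  let ?Q = "left_localization R S"
  have "left_frac R S s \<one> \<otimes>\<^bsub>?Q\<^esub> left_frac R S \<one> s = left_frac R S s s"
    using mult_left_frac[OF s one_closed S_one S_carrier[OF s] S_one one_closed] S_carrier[OF s] by simp
  also have "\<dots> = \<one>\<^bsub>?Q\<^esub>"
    using S_carrier[OF s] s S_one
    by (auto simp: left_localization_def intro!: left_frac_eqI ore_relI[of _ _ _ _ \<one> s])
  finally have "left_frac R S s \<one> \<otimes>\<^bsub>?Q\<^esub> left_frac R S \<one> s = \<one>\<^bsub>?Q\<^esub>" .
  moreover have "left_frac R S \<one> s \<otimes>\<^bsub>?Q\<^esub> left_frac R S s \<one> = \<one>\<^bsub>?Q\<^esub>"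
    using left_frac_clear_denominator[OF s one_closed] by (simp add: left_localization_def)
  moreover have "left_frac R S s \<one> \<in> carrier ?Q" "left_frac R S \<one> s \<in> carrier ?Q"
    using s S_one S_carrier by (auto simp: left_localization_def left_frac_def intro: quotientI)
  ultimately show ?thesis unfolding Units_def by blast
qed

lemma left_localization_ex_frac:
  assumes "X \<in> carrier (left_localization R S)"
  shows "\<exists>s\<in>S. \<exists>r\<in>carrier R.
    left_frac R S \<one> s \<otimes>\<^bsub>left_localization R S\<^esub> X = left_frac R S \<one> r"
proof -
  have "X \<in> (S \<times> carrier R) // ore_rel R S" using assms by (simp add: left_localization_def)
  then obtain s r where "s \<in> S" "r \<in> carrier R" "X = left_frac R S s r"
    unfolding left_frac_def by (elim quotientE) auto
  then show ?thesis using left_frac_clear_denominator by blast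
qed

end

section \<open>Left orders in semisimple rings\<close>

context ring begin

lemma Units_right_annihilator:
  assumes u: "u \<in> Units R" and z: "z \<in> carrier R" "z \<otimes> u = \<zero>"
  shows "z = \<zero>"
proof -
  have "z = z \<otimes> (u \<otimes> inv u)" using u z by simp
  also have "\<dots> = (z \<otimes> u) \<otimes> inv u"
    using m_assoc[OF z(1) Units_closed[OF u] Units_inv_closed[OF u]] by simp
  also have "\<dots> = \<zero>" unfolding z(2) using u by simp
  finally show ?thesis .
qed

lemma Units_left_annihilator:
  assumes u: "u \<in> Units R" and z: "z \<in> carrier R" "u \<otimes> z = \<zero>"
  shows "z = \<zero>"
  using Units_l_cancel[OF u z(1) zero_closed] z(2) r_null[OF Units_closed[OF u]] by simp

text \<open>A common left multiple of two annihilating elements of \<open>S\<close> kills the sum;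
  for \<open>r \<otimes> x\<close> the Ore condition moves an annihilator of \<open>x\<close> past
  \<open>r\<close>.\<close>

lemma ass_left_ideal:
  assumes "left_ore_set R S" shows "left_ideal (ass R S) R"
proof (rule left_idealI)
  note S = left_ore_setD[OF assms]
  show "ass R S \<subseteq> carrier R" by (auto simp: ass_def)
  show "\<zero> \<in> ass R S" using S(2) by (auto simp: ass_def intro!: bexI[of _ \<one>])
  show "x \<oplus> y \<in> ass R S" if xy: "x \<in> ass R S" "y \<in> ass R S" for x y
  proof -
    obtain s t where s: "s \<in> S" "t \<in> S" "x \<in> carrier R" "y \<in> carrier R" "s \<otimes> x = \<zero>" "t \<otimes> y = \<zero>"
      using xy by (auto simp: ass_def)
    note c = subsetD[OF S(1) s(1)] subsetD[OF S(1) s(2)]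
    obtain u v where u: "u \<in> S" "v \<in> carrier R" "u \<otimes> s = v \<otimes> t"
      using S(6)[OF c(1) s(2)] by blast
    note uc = subsetD[OF S(1) u(1)]
    have "(u \<otimes> s) \<otimes> x = \<zero>" using uc c s(3) by (simp add: m_assoc s(5))
    moreover have "(u \<otimes> s) \<otimes> y = \<zero>" unfolding u(3) using u(2) c s(4) by (simp add: m_assoc s(6))
    ultimately have "(u \<otimes> s) \<otimes> (x \<oplus> y) = \<zero>" using uc c s(3,4) by (simp add: r_distr)
    then show ?thesis using S(3)[OF u(1) s(1)] s(3,4) by (auto simp: ass_def)
  qed
  show "r \<otimes> x \<in> ass R S" if r: "r \<in> carrier R" and x: "x \<in> ass R S" for r x
  proof -
    obtain s where s: "s \<in> S" "x \<in> carrier R" "s \<otimes> x = \<zero>" using x by (auto simp: ass_def)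
    obtain t q where t: "t \<in> S" "q \<in> carrier R" "t \<otimes> r = q \<otimes> s" using S(6)[OF r s(1)] by blast
    have "t \<otimes> (r \<otimes> x) = (t \<otimes> r) \<otimes> x" using subsetD[OF S(1) t(1)] r s(2) by (simp add: m_assoc)
    also have "\<dots> = \<zero>"
      unfolding t(3) using t(2) s(2) subsetD[OF S(1) s(1)] by (simp add: m_assoc s(3))
    finally show ?thesis using t(1) r s(2) by (auto simp: ass_def)
  qed
qed

lemma ass_r_closed:
  assumes "left_ore_set R S" and x: "x \<in> ass R S" and r: "r \<in> carrier R"
  shows "x \<otimes> r \<in> ass R S"
proof -
  obtain s where s: "s \<in> S" "x \<in> carrier R" "s \<otimes> x = \<zero>" using x by (auto simp: ass_def)
  have sc: "s \<in> carrier R" using left_ore_setD(1)[OF assms(1)] s by blast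
  have "s \<otimes> (x \<otimes> r) = \<zero>" using m_assoc[OF sc s(2) r] s(3) r by simp
  then show ?thesis using s r by (auto simp: ass_def)
qed

end

text \<open>This keeps what the argument uses of a localization and forgets the Ore set: a
  denominator is any \<open>c\<close> with unit image. One argument thus serves for all three
  quotient rings.\<close>

locale semisimple_left_order = R: ring R + Q: ring Q
  for R :: "('a, 'm) ring_scheme" and Q :: "('b, 'n) ring_scheme" (structure) +
  fixes \<phi> :: "'a \<Rightarrow> 'b"
  assumes hom: "\<phi> \<in> ring_hom R Q" and inj: "inj_on \<phi> (carrier R)"
    and frac: "q \<in> carrier Q \<Longrightarrow> \<exists>c\<in>carrier R. \<exists>r\<in>carrier R. \<phi> c \<in> Units Q \<and> \<phi> c \<otimes> q = \<phi> r"
    and semisimple: "semisimple_ring Q"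
begin

lemmas hom_simps [simp] = ring_hom_closed[OF hom] ring_hom_mult[OF hom] ring_hom_add[OF hom]
  ring_hom_one[OF hom] ring_hom_zero[OF hom R.ring_axioms Q.ring_axioms]

lemma hom_injD: "x \<in> carrier R \<Longrightarrow> y \<in> carrier R \<Longrightarrow> \<phi> x = \<phi> y \<Longrightarrow> x = y"
  using inj by (rule inj_onD)

lemma hom_zeroD: "x \<in> carrier R \<Longrightarrow> \<phi> x = \<zero> \<Longrightarrow> x = \<zero>\<^bsub>R\<^esub>"
  by (rule hom_injD) auto

lemma artinian: "left_artinian Q"
  using semisimple by (simp add: semisimple_ring_def)

lemma Q_one_not_zero: "\<one> \<noteq> \<zero>"
  using semisimple by (simp add: semisimple_ring_def)

text \<open>If \<open>z \<otimes> \<phi> c = \<zero>\<close>, clearing the denominator of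
  \<open>z\<close> gives a numerator \<open>r\<close> with \<open>r c = 0\<close> in
  \<open>R\<close>, so \<open>r\<close> and \<open>z\<close> vanish. The chain condition does the
  rest.\<close>

lemma regular_Units:
  assumes c: "c \<in> \<C> R" shows "\<phi> c \<in> Units Q"
proof (rule Q.left_artinian_Units[OF artinian])
  note cc = R.regular_elementsD[OF c]
  show "\<phi> c \<in> carrier Q" using cc(1) by simp
  fix z assume z: "z \<in> carrier Q" "z \<otimes> \<phi> c = \<zero>"
  obtain d r where d: "d \<in> carrier R" "r \<in> carrier R" "\<phi> d \<in> Units Q" "\<phi> d \<otimes> z = \<phi> r"
    using frac[OF z(1)] by blast
  have "\<phi> (r \<otimes>\<^bsub>R\<^esub> c) = (\<phi> d \<otimes> z) \<otimes> \<phi> c" using cc(1) d by simp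
  also have "\<dots> = \<zero>" using d(1) cc(1) z by (simp add: Q.m_assoc)
  finally have "r \<otimes>\<^bsub>R\<^esub> c = \<zero>\<^bsub>R\<^esub>" using cc(1) d(2) by (intro hom_zeroD) simp_all
  then have "r = \<zero>\<^bsub>R\<^esub>" by (rule cc(3)[OF d(2)])
  then have "\<phi> d \<otimes> z = \<zero>" using d(4) by simp
  then show "z = \<zero>" by (rule Q.Units_left_annihilator[OF d(3) z(1)])
qed

lemma regularI:
  assumes c: "c \<in> carrier R" and u: "\<phi> c \<in> Units Q" shows "c \<in> \<C> R"
proof (rule R.regular_elementsI[OF c])
  fix x assume x: "x \<in> carrier R"
  show "x = \<zero>\<^bsub>R\<^esub>" if "c \<otimes>\<^bsub>R\<^esub> x = \<zero>\<^bsub>R\<^esub>"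
  proof (rule hom_zeroD[OF x], rule Q.Units_left_annihilator[OF u])
    show "\<phi> c \<otimes> \<phi> x = \<zero>" using arg_cong[OF that, of \<phi>] x c by simp
  qed (use x in simp)
  show "x = \<zero>\<^bsub>R\<^esub>" if "x \<otimes>\<^bsub>R\<^esub> c = \<zero>\<^bsub>R\<^esub>"
  proof (rule hom_zeroD[OF x], rule Q.Units_right_annihilator[OF u])
    show "\<phi> x \<otimes> \<phi> c = \<zero>" using arg_cong[OF that, of \<phi>] x c by simp
  qed (use x in simp)
qed

lemma regular_frac:
  assumes "q \<in> carrier Q"
  obtains c r where "c \<in> \<C> R" "c \<in> carrier R" "r \<in> carrier R" "\<phi> c \<in> Units Q" "\<phi> c \<otimes> q = \<phi> r"
  using frac[OF assms] regularI by blast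

lemma regular_elements_left_ore: "left_ore_set R (\<C> R)"
proof (rule R.left_ore_setI[OF R.regular_elements_submonoid])
  show "\<zero>\<^bsub>R\<^esub> \<notin> \<C> R"
  proof
    assume "\<zero>\<^bsub>R\<^esub> \<in> \<C> R"
    then have "\<zero> \<in> Units Q" using regular_Units by fastforce
    then have "\<one> = \<zero>" by (rule Q.Units_right_annihilator) simp_all
    then show False using Q_one_not_zero by simp
  qed
  fix r c assume r: "r \<in> carrier R" and c: "c \<in> \<C> R"
  note u = regular_Units[OF c] and cc = R.regular_elementsD(1)[OF c]
  have i: "inv (\<phi> c) \<in> carrier Q" "inv (\<phi> c) \<otimes> \<phi> c = \<one>" using u by simp_all
  \<comment> \<open>Rewriting the right fraction \<open>r c^-1\<close> as a left fraction
    \<open>d^-1 q\<close> is the Ore condition \<open>d r = q c\<close>.\<close>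
  have "\<phi> r \<otimes> inv (\<phi> c) \<in> carrier Q" using r i by simp
  then obtain d q where d: "d \<in> \<C> R" "d \<in> carrier R" "q \<in> carrier R"
    "\<phi> d \<otimes> (\<phi> r \<otimes> inv (\<phi> c)) = \<phi> q"
    using regular_frac by metis
  have "\<phi> (q \<otimes>\<^bsub>R\<^esub> c) = (\<phi> d \<otimes> (\<phi> r \<otimes> inv (\<phi> c))) \<otimes> \<phi> c" using d cc by simp
  also have "\<dots> = \<phi> (d \<otimes>\<^bsub>R\<^esub> r)" using d(2) r i cc by (simp add: Q.m_assoc)
  finally have "d \<otimes>\<^bsub>R\<^esub> r = q \<otimes>\<^bsub>R\<^esub> c" using d r cc by (intro hom_injD) simp_all
  then show "\<exists>t\<in>\<C> R. \<exists>q\<in>carrier R. t \<otimes>\<^bsub>R\<^esub> r = q \<otimes>\<^bsub>R\<^esub> c" using d by blast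
qed

section \<open>Extension of ideals from \<open>R\<close> to \<open>Q\<close>\<close>

text \<open>For a left ideal \<open>I\<close> this is the left ideal of \<open>Q\<close> generated
  by the image of \<open>I\<close>, in a form that gives each element a single denominator.\<close>

definition frac_ideal :: "'a set \<Rightarrow> 'b set" where
  "frac_ideal I = {q \<in> carrier Q. \<exists>c\<in>\<C> R. \<exists>a\<in>I. \<phi> c \<otimes> q = \<phi> a}"

lemma frac_ideal_left_ideal:
  assumes I: "left_ideal I R" shows "left_ideal (frac_ideal I) Q"
proof (rule Q.left_idealI)
  note ID = R.left_idealD[OF I] and C = R.left_ore_setD[OF regular_elements_left_ore]
  show "frac_ideal I \<subseteq> carrier Q" by (auto simp: frac_ideal_def)
  have "\<phi> \<one>\<^bsub>R\<^esub> \<otimes> \<zero> = \<phi> \<zero>\<^bsub>R\<^esub>" by simp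
  then show "\<zero> \<in> frac_ideal I" using ID(2) C(2) unfolding frac_ideal_def by blast
  show "x \<oplus> y \<in> frac_ideal I" if "x \<in> frac_ideal I" "y \<in> frac_ideal I" for x y
  proof -
    obtain c a d b where c: "c \<in> \<C> R" "a \<in> I" "\<phi> c \<otimes> x = \<phi> a" "x \<in> carrier Q"
      and d: "d \<in> \<C> R" "b \<in> I" "\<phi> d \<otimes> y = \<phi> b" "y \<in> carrier Q"
      using \<open>x \<in> frac_ideal I\<close> \<open>y \<in> frac_ideal I\<close> unfolding frac_ideal_def by blast
    have cc: "c \<in> carrier R" "d \<in> carrier R" "a \<in> carrier R" "b \<in> carrier R"
      using C(1) ID(1) c(1,2) d(1,2) by auto
    obtain u v where u: "u \<in> \<C> R" "v \<in> carrier R" "u \<otimes>\<^bsub>R\<^esub> c = v \<otimes>\<^bsub>R\<^esub> d"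
      using C(6)[OF cc(1) d(1)] by blast
    have uc: "u \<in> carrier R" using C(1) u(1) by blast
    have 1: "\<phi> (u \<otimes>\<^bsub>R\<^esub> c) \<otimes> x = \<phi> (u \<otimes>\<^bsub>R\<^esub> a)"
      using uc cc c(4) by (simp add: Q.m_assoc c(3))
    have 2: "\<phi> (u \<otimes>\<^bsub>R\<^esub> c) \<otimes> y = \<phi> (v \<otimes>\<^bsub>R\<^esub> b)"
      unfolding u(3) using u(2) cc d(4) by (simp add: Q.m_assoc d(3))
    have "\<phi> (u \<otimes>\<^bsub>R\<^esub> c) \<otimes> (x \<oplus> y) = \<phi> (u \<otimes>\<^bsub>R\<^esub> c) \<otimes> x \<oplus> \<phi> (u \<otimes>\<^bsub>R\<^esub> c) \<otimes> y"
      by (rule Q.r_distr) (use c(4) d(4) uc cc in simp_all)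
    also have "\<dots> = \<phi> (u \<otimes>\<^bsub>R\<^esub> a \<oplus>\<^bsub>R\<^esub> v \<otimes>\<^bsub>R\<^esub> b)"
      unfolding 1 2 using uc u(2) cc by simp
    finally show ?thesis
      using C(3)[OF u(1) c(1)] ID(3)[OF ID(4)[OF uc c(2)] ID(4)[OF u(2) d(2)]] c(4) d(4)
      unfolding frac_ideal_def by blast
  qed
  show "q \<otimes> x \<in> frac_ideal I" if q: "q \<in> carrier Q" and x: "x \<in> frac_ideal I" for q x
  proof -
    obtain c a where c: "c \<in> \<C> R" "a \<in> I" "\<phi> c \<otimes> x = \<phi> a" "x \<in> carrier Q"
      using x unfolding frac_ideal_def by blast
    note u = regular_Units[OF c(1)] and cc = R.regular_elementsD(1)[OF c(1)]
    have i: "inv (\<phi> c) \<in> carrier Q" "inv (\<phi> c) \<otimes> \<phi> c = \<one>" using u by simp_all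
    \<comment> \<open>With \<open>x = c^-1 a\<close>, writing \<open>q c^-1\<close> as
      \<open>d^-1 r\<close> turns \<open>q x\<close> into \<open>d^-1 (r a)\<close>.\<close>
    have "q \<otimes> inv (\<phi> c) \<in> carrier Q" using q i by simp
    then obtain d r where d: "d \<in> \<C> R" "d \<in> carrier R" "r \<in> carrier R"
      "\<phi> d \<otimes> (q \<otimes> inv (\<phi> c)) = \<phi> r"
      using regular_frac by metis
    have ac: "a \<in> carrier R" using ID(1) c(2) by blast
    have "x = inv (\<phi> c) \<otimes> \<phi> a"
      using i cc c(4) by (simp flip: c(3) Q.m_assoc)
    then have "\<phi> d \<otimes> (q \<otimes> x) = (\<phi> d \<otimes> (q \<otimes> inv (\<phi> c))) \<otimes> \<phi> a"
      using i q d(2) ac by (simp add: Q.m_assoc)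
    also have "\<dots> = \<phi> (r \<otimes>\<^bsub>R\<^esub> a)" using d(3,4) ac by simp
    finally show ?thesis
      using d(1) ID(4)[OF d(3) c(2)] q c(4) unfolding frac_ideal_def by blast
  qed
qed

text \<open>
  Right closure under inverses of regular elements is where the chain condition enters:
  right multiplication by a unit that maps a left ideal into itself maps it onto itself.
\<close>

lemma frac_ideal_ideal:
  assumes I: "left_ideal I R" and r: "\<And>x r. x \<in> I \<Longrightarrow> r \<in> carrier R \<Longrightarrow> x \<otimes>\<^bsub>R\<^esub> r \<in> I"
  shows "ideal (frac_ideal I) Q"
proof (rule Q.ideal_if_left_ideal)
  note ID = R.left_idealD[OF I]
  show left: "left_ideal (frac_ideal I) Q" by (rule frac_ideal_left_ideal[OF I])
  note BD = Q.left_idealD[OF left]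
  have R_closed: "x \<otimes> \<phi> r \<in> frac_ideal I" if x: "x \<in> frac_ideal I" and r: "r \<in> carrier R" for x r
  proof -
    obtain c a where c: "c \<in> \<C> R" "a \<in> I" "\<phi> c \<otimes> x = \<phi> a" "x \<in> carrier Q"
      using x unfolding frac_ideal_def by blast
    have ac: "a \<in> carrier R" using ID(1) c(2) by blast
    have "\<phi> c \<otimes> (x \<otimes> \<phi> r) = (\<phi> c \<otimes> x) \<otimes> \<phi> r"
      using R.regular_elementsD(1)[OF c(1)] c(4) r by (simp add: Q.m_assoc)
    also have "\<dots> = \<phi> (a \<otimes>\<^bsub>R\<^esub> r)" unfolding c(3) using ac r by simp
    finally show ?thesis
      using c(1,4) assms(2)[OF c(2) r] r Q.m_closed[OF c(4)] hom_simps(1)[OF r]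
      unfolding frac_ideal_def by blast
  qed
  fix x q assume x: "x \<in> frac_ideal I" and q: "q \<in> carrier Q"
  obtain c r where c: "c \<in> \<C> R" "c \<in> carrier R" "r \<in> carrier R" "\<phi> c \<in> Units Q" "\<phi> c \<otimes> q = \<phi> r"
    using regular_frac[OF q] by blast
  obtain y where y: "y \<in> frac_ideal I" "x = y \<otimes> \<phi> c"
    using Q.left_artinian_right_mult_stable[OF artinian left hom_simps(1)[OF c(2)]
        Q.Units_right_annihilator[OF c(4)] R_closed[OF _ c(2)] x] by blast
  have "x \<otimes> q = y \<otimes> \<phi> r"
    using subsetD[OF BD(1) y(1)] c(2) q by (simp add: y(2) Q.m_assoc c(5))
  then show "x \<otimes> q \<in> frac_ideal I" using R_closed[OF y(1) c(3)] by simp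
qed

text \<open>\<open>e\<close> is the central identity of the extension of \<open>ass R S\<close> to
  \<open>Q\<close>. It has a numerator in \<open>ass R S\<close>, so one single \<open>s\<close> in
  \<open>S\<close> kills \<open>e\<close> and with it every element fixed by
  \<open>e\<close>.\<close>

lemma ass_central_element:
  assumes S: "S \<in> Den_l R"
  obtains e where "e \<in> carrier Q" "e \<otimes> e = e" "\<And>x. x \<in> carrier Q \<Longrightarrow> x \<otimes> e = e \<otimes> x"
    "\<And>r. r \<in> carrier R \<Longrightarrow> r \<in> ass R S \<longleftrightarrow> \<phi> r \<otimes> e = \<phi> r"
proof -
  note ore = R.Den_lD(1)[OF S]
  have "ideal (frac_ideal (ass R S)) Q"
    using R.ass_left_ideal[OF ore] R.ass_r_closed[OF ore] by (rule frac_ideal_ideal)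
  then obtain e where e: "e \<in> frac_ideal (ass R S)" "\<And>b. b \<in> frac_ideal (ass R S) \<Longrightarrow> b \<otimes> e = b"
    and central: "\<And>x. x \<in> carrier Q \<Longrightarrow> x \<otimes> e = e \<otimes> x"
    using Q.semisimple_ideal_central_identity[OF semisimple] by blast
  obtain d a where d: "d \<in> \<C> R" "a \<in> ass R S" "\<phi> d \<otimes> e = \<phi> a" "e \<in> carrier Q"
    using e(1) unfolding frac_ideal_def by blast
  obtain s where s: "s \<in> S" "a \<in> carrier R" "s \<otimes>\<^bsub>R\<^esub> a = \<zero>\<^bsub>R\<^esub>"
    using d(2) by (auto simp: ass_def)
  have sc: "s \<in> carrier R" using R.left_ore_setD(1)[OF ore] s(1) by blast
  note dc = R.regular_elementsD(1)[OF d(1)]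
  have "(\<phi> s \<otimes> e) \<otimes> \<phi> d = \<phi> s \<otimes> (\<phi> d \<otimes> e)"
    using sc dc d(4) central[of "\<phi> d"] by (simp add: Q.m_assoc)
  also have "\<dots> = \<zero>" unfolding d(3) using arg_cong[OF s(3), of \<phi>] sc s(2) by simp
  finally have se: "\<phi> s \<otimes> e = \<zero>"
    by (rule Q.Units_right_annihilator[OF regular_Units[OF d(1)], rotated]) (use sc d(4) in simp)
  have "r \<in> ass R S \<longleftrightarrow> \<phi> r \<otimes> e = \<phi> r" if r: "r \<in> carrier R" for r
  proof
    assume a: "r \<in> ass R S"
    have "\<phi> \<one>\<^bsub>R\<^esub> \<otimes> \<phi> r = \<phi> r" using r by simp
    then have "\<phi> r \<in> frac_ideal (ass R S)"
      using R.left_ore_setD(2)[OF regular_elements_left_ore] a hom_simps(1)[OF r]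
      unfolding frac_ideal_def by blast
    then show "\<phi> r \<otimes> e = \<phi> r" by (rule e(2))
  next
    assume re: "\<phi> r \<otimes> e = \<phi> r"
    have "\<phi> (s \<otimes>\<^bsub>R\<^esub> r) = \<phi> s \<otimes> (e \<otimes> \<phi> r)"
      using sc r re central[of "\<phi> r"] by simp
    also have "\<dots> = (\<phi> s \<otimes> e) \<otimes> \<phi> r" using sc r d(4) by (simp add: Q.m_assoc)
    also have "\<dots> = \<zero>" unfolding se using r by simp
    finally have "s \<otimes>\<^bsub>R\<^esub> r = \<zero>\<^bsub>R\<^esub>" using sc r by (intro hom_zeroD) simp_all
    then show "r \<in> ass R S" using s(1) r by (auto simp: ass_def)
  qed
  with d(4) e(2)[OF e(1)] central that show ?thesis by blast
qed

text \<open>A numerator \<open>r\<close> of \<open>x\<close> satisfies \<open>r s = 0\<close>, so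
  the denominator condition puts it into \<open>ass R S\<close> and \<open>e\<close> fixes it. But
  \<open>x \<otimes> e = \<zero>\<close> says that \<open>e\<close> kills it.\<close>

lemma Den_l_regular_on_complement:
  assumes S: "S \<in> Den_l R" and e: "e \<in> carrier Q" "\<And>x. x \<in> carrier Q \<Longrightarrow> x \<otimes> e = e \<otimes> x"
    "\<And>r. r \<in> carrier R \<Longrightarrow> r \<in> ass R S \<longleftrightarrow> \<phi> r \<otimes> e = \<phi> r"
    and x: "x \<in> carrier Q" "x \<otimes> e = \<zero>" and s: "s \<in> S" "x \<otimes> \<phi> s = \<zero>"
  shows "x = \<zero>"
proof -
  note ore = R.Den_lD(1)[OF S]
  have sc: "s \<in> carrier R" using R.left_ore_setD(1)[OF ore] s(1) by blast
  obtain c r where c: "c \<in> \<C> R" "c \<in> carrier R" "r \<in> carrier R" "\<phi> c \<in> Units Q" "\<phi> c \<otimes> x = \<phi> r"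
    using regular_frac[OF x(1)] by blast
  have "\<phi> (r \<otimes>\<^bsub>R\<^esub> s) = \<phi> c \<otimes> (x \<otimes> \<phi> s)"
    using c(2,3) sc x(1) by (simp add: Q.m_assoc flip: c(5))
  then have "r \<otimes>\<^bsub>R\<^esub> s = \<zero>\<^bsub>R\<^esub>" using s(2) c(2,3) sc by (intro hom_zeroD) simp_all
  then have "r \<in> ass R S" using R.Den_lD(2)[OF S c(3) s(1)] c(3) by (auto simp: ass_def)
  then have "\<phi> r = \<phi> r \<otimes> e" using e(3)[OF c(3)] by simp
  also have "\<dots> = \<phi> c \<otimes> (x \<otimes> e)" using c(2) x(1) e(1) by (simp add: Q.m_assoc flip: c(5))
  also have "\<dots> = \<zero>" using x(2) c(2) by simp
  finally have "\<phi> c \<otimes> x = \<zero>" using c(5) by simp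
  then show ?thesis by (rule Q.Units_left_annihilator[OF c(4) x(1)])
qed

section \<open>Regular elements and maximal denominator sets\<close>

lemma regular_elements_Den_l: "\<C> R \<in> Den_l R"
  using R.Den_l_ass_zero_iff[of "\<C> R"] regular_elements_left_ore by simp

lemma regular_elements_le_max_Den_l:
  assumes M: "M \<in> max_Den_l R" shows "\<C> R \<subseteq> M"
proof -
  have MD: "M \<in> Den_l R" using M by (simp add: max_Den_l_def)
  note ore = R.left_ore_setD[OF R.Den_lD(1)[OF MD]]
  obtain e where ee: "e \<otimes> e = e" and e: "e \<in> carrier Q" "\<And>x. x \<in> carrier Q \<Longrightarrow> x \<otimes> e = e \<otimes> x"
    "\<And>r. r \<in> carrier R \<Longrightarrow> r \<in> ass R M \<longleftrightarrow> \<phi> r \<otimes> e = \<phi> r"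
    using ass_central_element[OF MD] by blast
  let ?F = "{\<C> R, M}"
  have F: "?F \<subseteq> Den_l R" using MD regular_elements_Den_l by simp
  have X: "\<Union> ?F \<subseteq> carrier R" using ore(1) R.regular_elementsD(1) by auto
  have G: "gen_monoid R (\<Union> ?F) \<subseteq> carrier R"
    by (rule R.gen_monoid_minimal[OF X R.submonoid_carrier])
  \<comment> \<open>The condition \<open>x \<otimes> e = \<zero>\<close> describes the complement of
    \<open>Q e\<close>. Since \<open>e\<close> is central, right multiplication preserves it, so
    injectivity passes from the generators to all words.\<close>
  have gen: "x = \<zero>" if "g \<in> gen_monoid R (\<Union> ?F)" "x \<in> carrier Q" "x \<otimes> e = \<zero>" "x \<otimes> \<phi> g = \<zero>"
    for g x
    using that
  proof (induction arbitrary: x)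
    case one
    then show ?case by simp
  next
    case (mult y z)
    have c: "y \<in> carrier R" "z \<in> carrier R" using mult.hyps X G by auto
    have "x \<otimes> \<phi> y = \<zero>"
    proof (rule mult.IH)
      show "x \<otimes> \<phi> y \<in> carrier Q" using mult.prems c by simp
      show "(x \<otimes> \<phi> y) \<otimes> \<phi> z = \<zero>" using mult.prems c by (simp add: Q.m_assoc)
      have "(x \<otimes> \<phi> y) \<otimes> e = x \<otimes> (e \<otimes> \<phi> y)"
        using mult.prems(1) c(1) e(1) e(2)[of "\<phi> y"] by (simp add: Q.m_assoc)
      also have "\<dots> = (x \<otimes> e) \<otimes> \<phi> y" using mult.prems(1) c(1) e(1) by (simp add: Q.m_assoc)
      also have "\<dots> = \<zero>" unfolding mult.prems(2) using c(1) by simp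
      finally show "(x \<otimes> \<phi> y) \<otimes> e = \<zero>" .
    qed
    moreover from mult.hyps(1) have "y \<in> \<C> R \<or> y \<in> M" by auto
    ultimately show ?case
      using Q.Units_right_annihilator[OF regular_Units _ ] mult.prems(1,2)
        Den_l_regular_on_complement[OF MD e] by blast
  qed
  have "\<zero>\<^bsub>R\<^esub> \<notin> gen_monoid R (\<Union> ?F)"
  proof
    assume z: "\<zero>\<^bsub>R\<^esub> \<in> gen_monoid R (\<Union> ?F)"
    \<comment> \<open>Were zero a word, the complement would be trivial and
      \<open>e = \<one>\<close>; then some element of \<open>M\<close> would kill the unit of
      \<open>R\<close>, that is, be zero.\<close>
    have "(\<one> \<ominus> e) \<otimes> e = \<zero>" using e(1) ee by (simp add: Q.minus_mult_distrib)
    then have "\<one> \<ominus> e = \<zero>" using gen[OF z, of "\<one> \<ominus> e"] e(1) by simp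
    then have "\<one>\<^bsub>R\<^esub> \<in> ass R M" using e(1) ee e(3)[of "\<one>\<^bsub>R\<^esub>"] by simp
    then show False using ore(1,4) by (auto simp: ass_def)
  qed
  then have "gen_monoid R (\<Union> ?F) \<in> Den_l R" by (rule R.gen_monoid_Den_l[OF F])
  moreover have incl: "\<Union> ?F \<subseteq> gen_monoid R (\<Union> ?F)" by (rule R.gen_monoid_incl[OF X])
  ultimately have "gen_monoid R (\<Union> ?F) = M" using M unfolding max_Den_l_def by blast
  with incl show ?thesis by blast
qed

text \<open>An \<open>s\<close> that is right regular on the component \<open>Q f\<close> acts there
  as a unit, by the chain condition, so fractions can be formed on that component. The second
  conclusion provides an element of \<open>S\<close> whose image lies in \<open>Q f\<close>.\<close>

lemma component_Den_l:
  assumes f: "f \<in> carrier Q" "f \<otimes> f = f" "f \<noteq> \<zero>" and central: "\<And>x. x \<in> carrier Q \<Longrightarrow> x \<otimes> f = f \<otimes> x"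
    and S: "S = {s \<in> carrier R. \<forall>z\<in>carrier Q. z \<otimes> f = z \<longrightarrow> z \<otimes> \<phi> s = \<zero> \<longrightarrow> z = \<zero>}"
  shows "S \<in> Den_l R" "\<exists>r\<in>S. \<exists>c\<in>carrier R. \<phi> r = \<phi> c \<otimes> f"
proof -
  have SI: "s \<in> S" if "s \<in> carrier R"
    "\<And>z. z \<in> carrier Q \<Longrightarrow> z \<otimes> f = z \<Longrightarrow> z \<otimes> \<phi> s = \<zero> \<Longrightarrow> z = \<zero>" for s
    unfolding S using that by blast
  have SC: "s \<in> carrier R" if "s \<in> S" for s
    using that unfolding S by blast
  have SD: "z = \<zero>" if "s \<in> S" "z \<in> carrier Q" "z \<otimes> f = z" "z \<otimes> \<phi> s = \<zero>" for s z
    using that unfolding S by blast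
  have swap: "(x \<otimes> y) \<otimes> f = (x \<otimes> f) \<otimes> y" if "x \<in> carrier Q" "y \<in> carrier Q" for x y
    using that f(1) central[of y] by (simp add: Q.m_assoc)
  have mult: "s \<otimes>\<^bsub>R\<^esub> t \<in> S" if s: "s \<in> S" and t: "t \<in> S" for s t
  proof (rule SI)
    note c = SC[OF s] SC[OF t]
    show "s \<otimes>\<^bsub>R\<^esub> t \<in> carrier R" using c by simp
    fix z assume z: "z \<in> carrier Q" "z \<otimes> f = z" "z \<otimes> \<phi> (s \<otimes>\<^bsub>R\<^esub> t) = \<zero>"
    have "z \<otimes> \<phi> s = \<zero>"
      by (rule SD[OF t]) (use z c swap[OF z(1), of "\<phi> s"] in \<open>simp_all add: Q.m_assoc\<close>)
    then show "z = \<zero>" by (rule SD[OF s z(1,2)])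
  qed
  have one: "\<one>\<^bsub>R\<^esub> \<in> S" by (rule SI) simp_all
  have regular: "c \<in> S" if c: "c \<in> \<C> R" for c
    by (rule SI[OF R.regular_elementsD(1)[OF c]]) (rule Q.Units_right_annihilator[OF regular_Units[OF c]])
  \<comment> \<open>\<open>r0\<close> is a numerator of \<open>f\<close>. Left multiplication by it
    forgets the part outside \<open>Q f\<close>, so identities valid after multiplication by
    \<open>f\<close> can be pulled back to \<open>R\<close>.\<close>
  obtain d0 r0 where d0: "d0 \<in> \<C> R" "d0 \<in> carrier R" "r0 \<in> carrier R" "\<phi> d0 \<in> Units Q"
    "\<phi> d0 \<otimes> f = \<phi> r0"
    using regular_frac[OF f(1)] by metis
  have r0: "r0 \<in> S"
  proof (rule SI[OF d0(3)])
    fix z assume z: "z \<in> carrier Q" "z \<otimes> f = z" "z \<otimes> \<phi> r0 = \<zero>"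
    have "z \<otimes> \<phi> d0 = (z \<otimes> \<phi> d0) \<otimes> f" using swap[OF z(1), of "\<phi> d0"] z(2) d0(2) by simp
    also have "\<dots> = \<zero>" using z d0(2,5) f(1) by (simp add: Q.m_assoc)
    finally show "z = \<zero>" by (rule Q.Units_right_annihilator[OF d0(4) z(1)])
  qed
  then show "\<exists>r\<in>S. \<exists>c\<in>carrier R. \<phi> r = \<phi> c \<otimes> f" using d0(2,5) by metis
  have r0_mult: "\<phi> (r0 \<otimes>\<^bsub>R\<^esub> r) = \<phi> d0 \<otimes> (\<phi> r \<otimes> f)" if "r \<in> carrier R" for r
    using that d0(2,3) f(1) central[of "\<phi> r"] by (simp add: Q.m_assoc flip: d0(5))
  have ore: "\<exists>t\<in>S. \<exists>q\<in>carrier R. t \<otimes>\<^bsub>R\<^esub> r = q \<otimes>\<^bsub>R\<^esub> s" if r: "r \<in> carrier R" and s: "s \<in> S" for r s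
  proof -
    have c: "\<phi> r \<in> carrier Q" "\<phi> s \<in> carrier Q" using r SC[OF s] by simp_all
    \<comment> \<open>\<open>u\<close> acts as \<open>s\<close> on \<open>Q f\<close> and as the
      identity on the complement, which makes it a unit of the whole ring \<open>Q\<close>.\<close>
    define u where "u = \<phi> s \<otimes> f \<oplus> (\<one> \<ominus> f)"
    have u: "u \<in> carrier Q" using c f(1) by (simp add: u_def)
    have uf: "u \<otimes> f = \<phi> s \<otimes> f"
      using c f by (simp add: u_def Q.l_distr Q.minus_mult_distrib Q.m_assoc)
    have unit: "u \<in> Units Q"
    proof (rule Q.left_artinian_Units[OF artinian u])
      fix z assume z: "z \<in> carrier Q" "z \<otimes> u = \<zero>"
      have zs: "z \<otimes> (\<phi> s \<otimes> f) = (z \<otimes> u) \<otimes> f" using z(1) u f(1) by (simp add: Q.m_assoc uf)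
      also have "\<dots> = \<zero>" using z(2) f(1) by simp
      finally have zs0: "z \<otimes> (\<phi> s \<otimes> f) = \<zero>" .
      have zf: "z \<otimes> f = \<zero>"
      proof (rule SD[OF s])
        show "(z \<otimes> f) \<otimes> \<phi> s = \<zero>"
          using zs0 swap[OF z(1) c(2)] z(1) c(2) f(1) by (simp add: Q.m_assoc)
      qed (use z(1) f in \<open>simp_all add: Q.m_assoc\<close>)
      have "z \<otimes> u = z \<otimes> (\<phi> s \<otimes> f) \<oplus> (z \<otimes> \<one> \<ominus> z \<otimes> f)"
        using z(1) c f(1) by (simp add: u_def Q.r_distr Q.minus_mult_distrib)
      also have "\<dots> = z" using zs0 zf z(1) by (simp add: Q.minus_eq)
      finally show "z = \<zero>" using z(2) by simp
    qed
    have i: "inv u \<in> carrier Q" "inv u \<otimes> u = \<one>" using unit by simp_all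
    have "\<phi> r \<otimes> inv u \<in> carrier Q" using c i by simp
    then obtain d q where d: "d \<in> \<C> R" "d \<in> carrier R" "q \<in> carrier R"
      "\<phi> d \<otimes> (\<phi> r \<otimes> inv u) = \<phi> q"
      using regular_frac by metis
    have "\<phi> (d \<otimes>\<^bsub>R\<^esub> r) = (\<phi> d \<otimes> (\<phi> r \<otimes> inv u)) \<otimes> u"
      using d(2) r i u by (simp add: Q.m_assoc)
    \<comment> \<open>\<open>u\<close> and \<open>\<phi> s\<close> agree after multiplication by
      \<open>f\<close>, so \<open>d r = q u\<close> becomes \<open>d r f = q s f\<close>; the factor
      \<open>r0\<close> then removes \<open>f\<close>.\<close>
    then have "\<phi> (d \<otimes>\<^bsub>R\<^esub> r) \<otimes> f = (\<phi> q \<otimes> u) \<otimes> f" by (simp only: d(4))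
    also have "\<dots> = \<phi> (q \<otimes>\<^bsub>R\<^esub> s) \<otimes> f"
      using d(3) u f(1) c SC[OF s] by (simp add: Q.m_assoc uf)
    finally have "\<phi> (r0 \<otimes>\<^bsub>R\<^esub> (d \<otimes>\<^bsub>R\<^esub> r)) = \<phi> (r0 \<otimes>\<^bsub>R\<^esub> (q \<otimes>\<^bsub>R\<^esub> s))"
      using r0_mult[of "d \<otimes>\<^bsub>R\<^esub> r"] r0_mult[of "q \<otimes>\<^bsub>R\<^esub> s"] d(2,3) r SC[OF s] by simp
    then have "r0 \<otimes>\<^bsub>R\<^esub> (d \<otimes>\<^bsub>R\<^esub> r) = r0 \<otimes>\<^bsub>R\<^esub> (q \<otimes>\<^bsub>R\<^esub> s)"
      by (rule hom_injD[rotated -1]) (use d(2,3) r SC[OF s] d0(3) in simp_all)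
    then have "(r0 \<otimes>\<^bsub>R\<^esub> d) \<otimes>\<^bsub>R\<^esub> r = (r0 \<otimes>\<^bsub>R\<^esub> q) \<otimes>\<^bsub>R\<^esub> s"
      using d(2,3) r SC[OF s] d0(3) by (simp add: R.m_assoc)
    then show ?thesis using mult[OF r0 regular[OF d(1)]] R.m_closed[OF d0(3) d(3)] by blast
  qed
  have den: "\<exists>t\<in>S. t \<otimes>\<^bsub>R\<^esub> r = \<zero>\<^bsub>R\<^esub>" if r: "r \<in> carrier R" and s: "s \<in> S"
    and rs: "r \<otimes>\<^bsub>R\<^esub> s = \<zero>\<^bsub>R\<^esub>" for r s
  proof -
    have c: "\<phi> r \<in> carrier Q" "\<phi> s \<in> carrier Q" using r SC[OF s] by simp_all
    have "\<phi> r \<otimes> \<phi> s = \<zero>" using arg_cong[OF rs, of \<phi>] r SC[OF s] by simp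
    then have "(\<phi> r \<otimes> f) \<otimes> \<phi> s = \<zero>" using swap[OF c] f(1) by simp
    then have "\<phi> r \<otimes> f = \<zero>"
      by (rule SD[OF s, rotated -1]) (use c f in \<open>simp_all add: Q.m_assoc\<close>)
    then have "\<phi> (r0 \<otimes>\<^bsub>R\<^esub> r) = \<zero>" using r0_mult[OF r] d0(2) by simp
    then have "r0 \<otimes>\<^bsub>R\<^esub> r = \<zero>\<^bsub>R\<^esub>" using d0(3) r by (intro hom_zeroD) simp_all
    with r0 show ?thesis by blast
  qed
  have "\<zero>\<^bsub>R\<^esub> \<notin> S" using SD[of "\<zero>\<^bsub>R\<^esub>" f] f by auto
  moreover have "submonoid S R" using mult one SC by (intro submonoid.intro) auto
  ultimately show "S \<in> Den_l R" using ore den by (intro R.Den_lI R.left_ore_setI)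
qed

lemma R_one_not_zero: "\<one>\<^bsub>R\<^esub> \<noteq> \<zero>\<^bsub>R\<^esub>"
  using Q_one_not_zero hom_simps(4,5) by metis

lemma strong_l_le_regular_elements: "\<L>\<^sup>s\<^sub>l R \<subseteq> \<C> R"
proof
  fix x assume x: "x \<in> \<L>\<^sup>s\<^sub>l R"
  then have xc: "x \<in> carrier R"
    using submonoid.subset[OF R.strong_l_submonoid(1)[OF R_one_not_zero]] by blast
  show "x \<in> \<C> R"
  proof (rule regularI[OF xc], rule Q.left_artinian_Units[OF artinian])
    show "\<phi> x \<in> carrier Q" using xc by simp
    fix y assume y: "y \<in> carrier Q" "y \<otimes> \<phi> x = \<zero>"
    show "y = \<zero>"
    proof (rule ccontr)
      assume y0: "y \<noteq> \<zero>"
      let ?B = "Idl\<^bsub>Q\<^esub> {y}"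
      have B: "ideal ?B Q" using y(1) by (intro Q.genideal_ideal) simp
      have yB: "y \<in> ?B" using Q.genideal_self'[OF y(1)] .
      obtain f where f: "f \<in> ?B" "\<And>b. b \<in> ?B \<Longrightarrow> b \<otimes> f = b"
        and central: "\<And>x. x \<in> carrier Q \<Longrightarrow> x \<otimes> f = f \<otimes> x"
        using Q.semisimple_ideal_central_identity[OF semisimple B] by metis
      have fc: "f \<in> carrier Q" using ideal.Icarr[OF B f(1)] .
      have f0: "f \<noteq> \<zero>" using f(2)[OF yB] y(1) y0 by auto
      define S where "S = {s \<in> carrier R. \<forall>z\<in>carrier Q. z \<otimes> f = z \<longrightarrow> z \<otimes> \<phi> s = \<zero> \<longrightarrow> z = \<zero>}"
      note S = component_Den_l[OF fc f(2)[OF f(1)] f0 central S_def]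
      obtain M where M: "M \<in> max_Den_l R" "S \<subseteq> M" using R.ex_max_Den_l[OF S(1)] by blast
      then have MD: "M \<in> Den_l R" by (simp add: max_Den_l_def)
      note ore = R.left_ore_setD[OF R.Den_lD(1)[OF MD]]
      obtain e where ee: "e \<otimes> e = e" and e: "e \<in> carrier Q" "\<And>x. x \<in> carrier Q \<Longrightarrow> x \<otimes> e = e \<otimes> x"
        "\<And>r. r \<in> carrier R \<Longrightarrow> r \<in> ass R M \<longleftrightarrow> \<phi> r \<otimes> e = \<phi> r"
        using ass_central_element[OF MD] by metis
      \<comment> \<open>The part of \<open>y\<close> outside \<open>Q e\<close> is still killed by
        \<open>\<phi> x\<close> on the right, and \<open>x\<close> belongs to
        \<open>M\<close>.\<close>
      have "y \<ominus> y \<otimes> e = \<zero>"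
      proof (rule Den_l_regular_on_complement[OF MD e])
        show "(y \<ominus> y \<otimes> e) \<otimes> e = \<zero>"
          using y(1) e(1) ee by (simp add: Q.minus_mult_distrib Q.m_assoc)
        show "x \<in> M" using x M(1) by (auto simp: strong_l_def)
        have "(y \<otimes> e) \<otimes> \<phi> x = (y \<otimes> \<phi> x) \<otimes> e"
          using y(1) e(1) xc e(2)[of "\<phi> x"] by (simp add: Q.m_assoc)
        also have "\<dots> = \<zero>" unfolding y(2) using e(1) by simp
        finally show "(y \<ominus> y \<otimes> e) \<otimes> \<phi> x = \<zero>"
          using y e(1) xc by (simp add: Q.minus_mult_distrib)
      qed (use y(1) e(1) in simp_all)
      then have "y \<otimes> e = y" using y(1) e(1) by simp
      \<comment> \<open>The elements fixed by \<open>e\<close> form an ideal containing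
        \<open>y\<close>, hence containing all of \<open>?B\<close> and its identity
        \<open>f\<close>.\<close>
      then have "?B \<subseteq> {z \<in> carrier Q. z \<otimes> e = z}"
        using y(1) by (intro Q.genideal_minimal Q.ideal_fixed_by_central e(1,2)) auto
      then have fe: "f \<otimes> e = f" using f(1) by blast
      \<comment> \<open>An element of \<open>S\<close> with image in \<open>Q f\<close> is fixed by
        \<open>e\<close>, so some \<open>s\<close> in \<open>M\<close> kills it. Both factors lie in
        \<open>M\<close>, and so would zero.\<close>
      obtain r c where r: "r \<in> S" "c \<in> carrier R" "\<phi> r = \<phi> c \<otimes> f" using S(2) by blast
      have rc: "r \<in> carrier R" using r(1) by (simp add: S_def)
      have "\<phi> r \<otimes> e = \<phi> r" unfolding r(3) using r(2) fc e(1) by (simp add: Q.m_assoc fe)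
      then have "r \<in> ass R M" using e(3)[OF rc] by simp
      then obtain s where "s \<in> M" "s \<otimes>\<^bsub>R\<^esub> r = \<zero>\<^bsub>R\<^esub>" by (auto simp: ass_def)
      then show False using ore(3)[of s r] ore(4) r(1) M(2) by auto
    qed
  qed
qed

lemma strong_l_eq_regular_elements: "\<L>\<^sup>s\<^sub>l R = \<C> R"
  using strong_l_le_regular_elements regular_elements_le_max_Den_l by (auto simp: strong_l_def)

lemma T_l_eq_regular_elements: "T_l R = \<C> R"
  using regular_elements_Den_l by (auto simp: T_l_def strong_l_eq_regular_elements)

lemma S_l_0_eq_regular_elements: "S_l_0 R = \<C> R"
  using R.S_l_0_greatest[OF R_one_not_zero] regular_elements_left_ore by blast

end

section \<open>Transfer to the three quotient rings\<close>

lemma semisimple_left_localization: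
  assumes "ring R" and S: "left_ore_set R S" "S \<subseteq> \<C> R"
    and ss: "semisimple_ring (left_localization R S)"
  shows "left_ore_set R (\<C> R)" "\<L>\<^sup>s\<^sub>l R = \<C> R" "T_l R = \<C> R" "S_l_0 R = \<C> R"
proof -
  interpret S: regular_ore_set R S
    using assms by (simp add: regular_ore_set_def regular_ore_set_axioms_def)
  interpret semisimple_left_order R "left_localization R S" "left_frac R S \<one>\<^bsub>R\<^esub>"
  proof (rule semisimple_left_order.intro)
    show "semisimple_left_order_axioms R (left_localization R S) (left_frac R S \<one>\<^bsub>R\<^esub>)"
      using S.left_frac_one_hom S.left_frac_one_inj S.left_localization_ex_frac
        S.left_frac_one_Units S.S_carrier ss
      by (intro semisimple_left_order_axioms.intro) blast+
  \<comment> \<open>The ring axioms of the localization come from its semisimplicity, of which they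
    are a part.\<close>
  qed (use assms(1) ss in \<open>simp_all add: semisimple_ring_def\<close>)
  show "left_ore_set R (\<C> R)" "\<L>\<^sup>s\<^sub>l R = \<C> R" "T_l R = \<C> R" "S_l_0 R = \<C> R"
    by (fact regular_elements_left_ore strong_l_eq_regular_elements T_l_eq_regular_elements
        S_l_0_eq_regular_elements)+
qed

theorem theorem1p4:
  fixes R :: "('a, 'm) ring_scheme"
  assumes "ring R" and "\<one>\<^bsub>R\<^esub> \<noteq> \<zero>\<^bsub>R\<^esub>"
  shows "((Q_l_cl_exists R \<and> semisimple_ring (Q_l_cl R)) \<longleftrightarrow> semisimple_ring (Q_l R)) \<and>
    (semisimple_ring (Q_l R) \<longleftrightarrow> (semisimple_ring (Q_l_s R) \<and> \<ll>\<^sup>s R = {\<zero>\<^bsub>R\<^esub>})) \<and>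
    ((Q_l_cl_exists R \<and> semisimple_ring (Q_l_cl R)) \<or> semisimple_ring (Q_l R) \<or>
       (semisimple_ring (Q_l_s R) \<and> \<ll>\<^sup>s R = {\<zero>\<^bsub>R\<^esub>}) \<longrightarrow>
     Q_l_cl R \<simeq> Q_l R \<and> Q_l R \<simeq> Q_l_s R \<and> \<C> R = T_l R \<and> T_l R = \<L>\<^sup>s\<^sub>l R)"
proof -
  interpret ring R by fact
  define P1 where "P1 \<longleftrightarrow> Q_l_cl_exists R \<and> semisimple_ring (Q_l_cl R)"
  define P2 where "P2 \<longleftrightarrow> semisimple_ring (Q_l R)"
  define P3 where "P3 \<longleftrightarrow> semisimple_ring (Q_l_s R) \<and> \<ll>\<^sup>s R = {\<zero>\<^bsub>R\<^esub>}"
  \<comment> \<open>\<open>E\<close> is the common consequence of the three conditions. Under it the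
    three quotient rings are localizations at the same set, so the equivalences and the isomorphisms
    are immediate.\<close>
  define E where "E \<longleftrightarrow> left_ore_set R (\<C> R) \<and> \<L>\<^sup>s\<^sub>l R = \<C> R \<and> T_l R = \<C> R \<and> S_l_0 R = \<C> R"
  note main = semisimple_left_localization[OF assms(1)]
  have "E" if P1
    using main[of "\<C> R"] that unfolding E_def P1_def Q_l_cl_exists_def Q_l_cl_def by blast
  moreover have "E" if P2
    using main[OF S_l_0_greatest(1,2)[OF assms(2)]] that unfolding E_def P2_def Q_l_def by blast
  moreover have "E" if P3
  proof -
    \<comment> \<open>The vanishing of the strong radical is what makes \<open>T_l R\<close> consist
      of regular elements.\<close>
    have "T_l R \<in> Den_l R \<and> ass R (T_l R) = {\<zero>\<^bsub>R\<^esub>}"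
      using T_l_Den_l[OF assms(2)] that by (simp add: P3_def strong_radical_l_def)
    then show ?thesis
      using main[of "T_l R"] that unfolding Den_l_ass_zero_iff E_def P3_def Q_l_s_def by blast
  qed
  moreover have "(P1 \<longleftrightarrow> P2) \<and> (P2 \<longleftrightarrow> P3) \<and> Q_l_cl R \<simeq> Q_l R \<and> Q_l R \<simeq> Q_l_s R" if E
  proof -
    have eq: "T_l R = \<C> R" "S_l_0 R = \<C> R" "left_ore_set R (\<C> R)"
      using that unfolding E_def by blast+
    then have "ass R (\<C> R) = {\<zero>\<^bsub>R\<^esub>}" using Den_l_ass_zero_iff[of "\<C> R"] by simp
    then show ?thesis
      by (simp add: P1_def P2_def P3_def Q_l_cl_exists_def Q_l_cl_def Q_l_def Q_l_s_def
          strong_radical_l_def eq ring_iso_refl)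
  qed
  ultimately have "(P1 \<longleftrightarrow> P2) \<and> (P2 \<longleftrightarrow> P3) \<and>
    (P1 \<or> P2 \<or> P3 \<longrightarrow> Q_l_cl R \<simeq> Q_l R \<and> Q_l R \<simeq> Q_l_s R \<and> E)"
    by blast
  then show ?thesis unfolding P1_def P2_def P3_def E_def by auto
qed

end
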